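(* Let $n,d\ge1$ be integers, let $\Delta^n=\{\mathbf{x}\in\mathbb{R}^n: 1-\sum_{i=1}^n x_i\ge 0,\ x_i\ge 0\ (1\le i\le n)\}$ be the standard simplex, equipped with the probability measure $d\mu_\Delta(\mathbf{x})=c_n\,x_1^{-1/2}\cdots x_n^{-1/2}(1-\sum_i x_i)^{-1/2}d\mathbf{x}$ (with $c_n>0$ a normalization constant), and let $f\in\mathbb{R}[\mathbf{x}]=\mathbb{R}[x_1,\dots,x_n]$ be a polynomial of degree $d$. Write $f_{\min}=\min_{\mathbf{x}\in \Delta^n}f(\mathbf{x})$, $f_{\max}=\max_{\mathbf{x}\in \Delta^n}f(\mathbf{x})$. Then for every integer $r\ge d$, the upper bound $\mathrm{ub}(f,\mathcal{T}(\Delta^n))_r$ (with respect to $\mu_\Delta$) satisfies $$\mathrm{ub}(f,\mathcal{T}(\Delta^n))_r-f_{\min}\le\frac{C_\Delta(n,d)}{2r^2}\,(f_{\max}-f_{\min}),\qquad\text{where } C_\Delta(n,d)=2n^2d^3\,\gamma(\Delta^n)_d .$$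
   Context: $\mathbb{R}[\mathbf{x}]_k$ denotes polynomials of degree at most $k$; $\Sigma[\mathbf{x}]$ denotes the set of sums of squares of polynomials in $\mathbb{R}[\mathbf{x}]$. Truncated preordering of the simplex: put $g_i=x_i$ for $1\le i\le n$, $g_{n+1}=1-\sum_{i=1}^n x_i$, and $g_J=\prod_{j\in J}g_j$ for $J\subseteq[n+1]$ ($g_\emptyset=1$). Then $$\mathcal{T}(\Delta^n)_{2r}=\Big\{\sum_{J\subseteq[n+1]}\sigma_J g_J:\ \sigma_J\in\Sigma[\mathbf{x}],\ \deg(\sigma_Jg_J)\le 2r\Big\}.$$ Upper bound: $$\mathrm{ub}(f,\mathcal{T}(\Delta^n))_r=\inf_{q\in\mathcal{T}(\Delta^n)_{2r}}\Big\{\int_{\Delta^n}f(\mathbf{x})q(\mathbf{x})\,d\mu_\Delta(\mathbf{x}):\ \int_{\Delta^n}q(\mathbf{x})\,d\mu_\Delta(\mathbf{x})=1\Big\}.$$ The constant $\gamma(\Delta^n)_d$: with the inner product $\langle p,q\rangle=\int_{\Delta^n}pq\,d\mu_\Delta$, let $H_k=\{p\in\mathbb{R}[\mathbf{x}]_k:\langle p,q\rangle=0\ \text{for all } q\in\mathbb{R}[\mathbf{x}]_{k-1}\}$ (with $H_0$ the constants). Every $p\in\mathbb{R}[\mathbf{x}]_d$ decomposes uniquely as $p=\sum_{k=0}^d p_k$ with $p_k\in H_k$. With $\|p\|_{\Delta^n}=\max_{\mathbf{x}\in\Delta^n}|p(\mathbf{x})|$, set $$\gamma(\Delta^n)_d=\max_{0\ne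 p\in\mathbb{R}[\mathbf{x}]_d}\ \max_{0\le k\le d}\frac{\|p_k\|_{\Delta^n}}{\|p\|_{\Delta^n}}<\infty .$$ *)

theory Defs
  imports "HOL-Analysis.Analysis" "HOL-Library.Poly_Mapping"
begin

text \<open>Real polynomials in finitely many variables \<open>x\<^sub>i\<close>, \<open>i :: 'n\<close>, are finitely supported maps
  from exponent vectors to coefficients, with the ring structure of
  \<^theory>\<open>HOL-Library.Poly_Mapping\<close>. The number of variables is \<open>CARD('n)\<close>.\<close>

type_synonym 'n rpoly = "('n \<Rightarrow>\<^sub>0 nat) \<Rightarrow>\<^sub>0 real"

definition var :: "'n \<Rightarrow> 'n rpoly" where
  "var i = Poly_Mapping.single (Poly_Mapping.single i 1) 1"

definition poly_eval :: "'n::finite rpoly \<Rightarrow> real ^ 'n \<Rightarrow> real" where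
  "poly_eval p x =
     (\<Sum>\<alpha>\<in>Poly_Mapping.keys p. Poly_Mapping.lookup p \<alpha> * (\<Prod>i\<in>UNIV. (x $ i) ^ Poly_Mapping.lookup \<alpha> i))"

text \<open>The total degree; the zero polynomial gets degree \<open>0\<close> and so satisfies every bound
  \<open>total_degree p \<le> k\<close>.\<close>

definition total_degree :: "'n::finite rpoly \<Rightarrow> nat" where
  "total_degree p =
     Max (insert 0 ((\<lambda>\<alpha>. \<Sum>i\<in>UNIV. Poly_Mapping.lookup \<alpha> i) ` Poly_Mapping.keys p))"

definition sos_polys :: "'n rpoly set" where
  "sos_polys = {s. \<exists>(m::nat) p. s = (\<Sum>i<m. (p i)\<^sup>2)}"

definition std_simplex :: "(real ^ 'n::finite) set" where
  "std_simplex = {x. 0 \<le> 1 - (\<Sum>i\<in>UNIV. x $ i) \<and> (\<forall>i. 0 \<le> x $ i)}"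

text \<open>On the boundary of the simplex, a null set, the weight takes the value \<open>0\<close>
  because \<open>0 powr a = 0\<close>.\<close>

definition simplex_weight :: "real ^ 'n::finite \<Rightarrow> real" where
  "simplex_weight x =
     (\<Prod>i\<in>UNIV. (x $ i) powr (- 1 / 2)) * (1 - (\<Sum>i\<in>UNIV. x $ i)) powr (- 1 / 2)"

definition simplex_const :: "'n::finite itself \<Rightarrow> real" where
  "simplex_const _ = 1 / (LINT x:(std_simplex :: (real ^ 'n) set)|lborel. simplex_weight x)"

definition simplex_measure :: "(real ^ 'n::finite) measure" where
  "simplex_measure =
     density lborel (\<lambda>x. ennreal (indicator std_simplex x * (simplex_const TYPE('n) * simplex_weight x)))"

text \<open>The constraints \<open>g\<^sub>1, \<dots>, g\<^sub>n\<close> are indexed by \<open>Some i\<close>, and \<open>g\<^sub>n\<^sub>+\<^sub>1\<close> by \<open>None\<close>.\<close>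

definition simplex_constraint :: "'n::finite option \<Rightarrow> 'n rpoly" where
  "simplex_constraint j = (case j of None \<Rightarrow> 1 - (\<Sum>i\<in>UNIV. var i) | Some i \<Rightarrow> var i)"

definition simplex_preordering :: "nat \<Rightarrow> 'n::finite rpoly set" where
  "simplex_preordering m =
     {(\<Sum>J\<in>UNIV. \<sigma> J * (\<Prod>j\<in>J. simplex_constraint j)) | \<sigma> :: 'n option set \<Rightarrow> 'n rpoly.
        \<forall>J. \<sigma> J \<in> sos_polys \<and> total_degree (\<sigma> J * (\<Prod>j\<in>J. simplex_constraint j)) \<le> m}"

definition simplex_ub :: "'n::finite rpoly \<Rightarrow> nat \<Rightarrow> real" where
  "simplex_ub f r =
     Inf {(LINT x|simplex_measure. poly_eval f x * poly_eval q x) | q.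
            q \<in> simplex_preordering (2 * r) \<and> (LINT x|simplex_measure. poly_eval q x) = 1}"

definition simplex_min :: "'n::finite rpoly \<Rightarrow> real" where
  "simplex_min f = (INF x\<in>std_simplex. poly_eval f x)"

definition simplex_max :: "'n::finite rpoly \<Rightarrow> real" where
  "simplex_max f = (SUP x\<in>std_simplex. poly_eval f x)"

definition simplex_norm :: "'n::finite rpoly \<Rightarrow> real" where
  "simplex_norm p = (SUP x\<in>std_simplex. \<bar>poly_eval p x\<bar>)"

definition simplex_inner :: "'n::finite rpoly \<Rightarrow> 'n rpoly \<Rightarrow> real" where
  "simplex_inner p q = (LINT x|simplex_measure. poly_eval p x * poly_eval q x)"

text \<open>Writing \<open>total_degree q < k\<close> instead of \<open>total_degree q \<le> k - 1\<close> makes \<open>H 0\<close> the constants.\<close>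

definition simplex_H :: "nat \<Rightarrow> 'n::finite rpoly set" where
  "simplex_H k = {p. total_degree p \<le> k \<and> (\<forall>q. total_degree q < k \<longrightarrow> simplex_inner p q = 0)}"

text \<open>The family \<open>h\<close> ranges over the decompositions \<open>p = h 0 + \<dots> + h d\<close> with \<open>h j \<in> H j\<close>,
  of which there is exactly one for each \<open>p\<close> of degree at most \<open>d\<close>.\<close>

definition simplex_gamma :: "'n::finite itself \<Rightarrow> nat \<Rightarrow> real" where
  "simplex_gamma _ d =
     Sup {simplex_norm (h k) / simplex_norm p | (p :: 'n rpoly) (h :: nat \<Rightarrow> 'n rpoly) k.
            p \<noteq> 0 \<and> total_degree p \<le> d \<and> k \<le> d \<and>
            (\<forall>j\<le>d. h j \<in> simplex_H j) \<and> p = (\<Sum>j\<le>d. h j)}"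

definition simplex_C :: "'n::finite itself \<Rightarrow> nat \<Rightarrow> real" where
  "simplex_C _ d = 2 * (real CARD('n))\<^sup>2 * (real d) ^ 3 * simplex_gamma TYPE('n) d"

end

theory Submission
  imports Defs "HOL-Computational_Algebra.Formal_Laurent_Series"
begin

text \<open>Only \<open>\<gamma> \<ge> 1\<close> is used. Lift \<open>x \<in> \<Delta>\<^sup>n\<close> to the points \<open>v\<close> of the unit sphere of \<open>\<real>\<^sup>n\<^sup>+\<^sup>1\<close> whose squared
  coordinates are the barycentric coordinates of \<open>x\<close>, and let \<open>u\<close> be a lift of a minimizer of \<open>f\<close>. On the
  great circle through \<open>u\<close> and \<open>v\<close>, \<open>f\<close> is a trigonometric polynomial of degree \<open>d\<close> in twice the angle,
  and a Bernstein-type inequality gives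
  \<open>f x - f_min \<le> d\<^sup>2 (1 - \<langle>u, v\<rangle>\<^sup>2) (f_max - f_min)\<close>.
  For a univariate polynomial \<open>P\<close> of degree at most \<open>r\<close>, the average over all lifts \<open>v\<close> of
  \<open>P (\<langle>u, v\<rangle>\<^sup>2)\<^sup>2\<close> is an element of the truncated preordering, by Parseval's identity for the sign changes.
  Its integral against \<open>\<mu>\<^sub>\<Delta>\<close> does not depend on \<open>u\<close>, and a suitable Jacobi polynomial \<open>P\<close> makes the mean of
  \<open>1 - \<langle>u, v\<rangle>\<^sup>2\<close> at most \<open>n\<^sup>2 / r\<^sup>2\<close>.\<close>

subsection \<open>Trigonometric polynomials\<close>

text \<open>A minimizer of \<open>f\<close> may lie on a face of the simplex, where the gradient of
  \<open>f\<close> need not vanish. The map from v to its squared coordinates removes the boundary: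
  the lifted function has a critical point at u, so it grows only quadratically along great circles.
  The same map sends the uniform measure of the sphere to the measure on the simplex, whence the
  exponents -1/2 and the independence of u. No surface measure is used: rotation invariance is
  replaced by a computation of moments from the Dirichlet integral. It lets u be exchanged for a
  coordinate vector, so that <u, v>^2 becomes a single coordinate of x with a Beta law, and the
  choice of \<open>P\<close> is a problem in one variable. The inequality gamma >= 1 has content
  because \<open>simplex_gamma\<close> is a supremum of reals, which dominates its elements only for
  a set bounded above. Boundedness comes from comparing sup norm and L2 norm in bounded degree, for
  which the same kernel is used again.\<close>

text \<open>A Laurent polynomial in \<open>cis \<psi>\<close> with frequencies from -k to k, shifted
  by k so that divisibility and derivatives of ordinary polynomials are available.\<close>

definition trig_poly :: "nat \<Rightarrow> (real \<Rightarrow> complex) \<Rightarrow> bool" where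
  "trig_poly k T \<longleftrightarrow> (\<exists>Q. degree Q \<le> 2 * k \<and> (\<forall>\<psi>. T \<psi> = cis (- (real k * \<psi>)) * poly Q (cis \<psi>)))"

lemma trig_polyI:
  assumes "degree Q \<le> 2 * k" "\<And>\<psi>. T \<psi> = cis (- (real k * \<psi>)) * poly Q (cis \<psi>)"
  shows "trig_poly k T"
  using assms unfolding trig_poly_def by blast

lemma trig_poly_const: "trig_poly 0 (\<lambda>_. c)"
  by (rule trig_polyI[of "[:c:]"]) auto

lemma trig_poly_mono:
  assumes "trig_poly k T" "k \<le> l"
  shows "trig_poly l T"
proof -
  from assms obtain Q where Q: "degree Q \<le> 2 * k" "\<And>\<psi>. T \<psi> = cis (- (real k * \<psi>)) * poly Q (cis \<psi>)"
    unfolding trig_poly_def by blast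
  show ?thesis
  proof (rule trig_polyI[of "monom 1 (l - k) * Q"])
    have "degree (monom (1::complex) (l - k) * Q) \<le> (l - k) + degree Q"
      by (rule order_trans[OF degree_mult_le]) (simp add: degree_monom_eq)
    then show "degree (monom 1 (l - k) * Q) \<le> 2 * l" using Q(1) assms(2) by simp
    fix \<psi>
    have "cis (- (real l * \<psi>)) * cis \<psi> ^ (l - k) = cis (- (real k * \<psi>))"
      unfolding Complex.DeMoivre cis_mult using assms(2)
      by (intro arg_cong[of _ _ cis]) (simp add: of_nat_diff left_diff_distrib)
    then show "T \<psi> = cis (- (real l * \<psi>)) * poly (monom 1 (l - k) * Q) (cis \<psi>)"
      by (simp add: Q(2) poly_monom mult.assoc[symmetric])
  qed
qed

lemma trig_poly_add:
  assumes "trig_poly k T" "trig_poly k U"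
  shows "trig_poly k (\<lambda>\<psi>. T \<psi> + U \<psi>)"
proof -
  from assms obtain Q Q' where "degree Q \<le> 2 * k" "\<And>\<psi>. T \<psi> = cis (- (real k * \<psi>)) * poly Q (cis \<psi>)"
    "degree Q' \<le> 2 * k" "\<And>\<psi>. U \<psi> = cis (- (real k * \<psi>)) * poly Q' (cis \<psi>)"
    unfolding trig_poly_def by blast
  then show ?thesis
    by (intro trig_polyI[of "Q + Q'"]) (auto simp: algebra_simps intro: degree_add_le)
qed

lemma trig_poly_mult:
  assumes "trig_poly k T" "trig_poly l U"
  shows "trig_poly (k + l) (\<lambda>\<psi>. T \<psi> * U \<psi>)"
proof -
  from assms obtain Q Q' where Q: "degree Q \<le> 2 * k" "\<And>\<psi>. T \<psi> = cis (- (real k * \<psi>)) * poly Q (cis \<psi>)"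
    "degree Q' \<le> 2 * l" "\<And>\<psi>. U \<psi> = cis (- (real l * \<psi>)) * poly Q' (cis \<psi>)"
    unfolding trig_poly_def by blast
  show ?thesis
  proof (rule trig_polyI[of "Q * Q'"])
    show "degree (Q * Q') \<le> 2 * (k + l)"
      using degree_mult_le[of Q Q'] Q(1) Q(3) by simp
    fix \<psi>
    have "cis (- (real (k + l) * \<psi>)) = cis (- (real k * \<psi>)) * cis (- (real l * \<psi>))"
      by (simp add: cis_mult algebra_simps)
    then show "T \<psi> * U \<psi> = cis (- (real (k + l) * \<psi>)) * poly (Q * Q') (cis \<psi>)"
      by (simp add: Q)
  qed
qed

lemma trig_poly_sum:
  assumes "finite A" "\<And>a. a \<in> A \<Longrightarrow> trig_poly k (T a)"
  shows "trig_poly k (\<lambda>\<psi>. \<Sum>a\<in>A. T a \<psi>)"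
  using assms
proof (induction A rule: finite_induct)
  case empty
  then show ?case using trig_poly_mono[OF trig_poly_const[of 0]] by simp
next
  case (insert a A)
  then show ?case by (simp add: trig_poly_add)
qed

lemma trig_poly_power:
  assumes "trig_poly k T"
  shows "trig_poly (k * m) (\<lambda>\<psi>. T \<psi> ^ m)"
proof (induction m)
  case 0
  then show ?case using trig_poly_const[of 1] by simp
next
  case (Suc m)
  then show ?case using trig_poly_mult[OF assms Suc] by simp
qed

lemma trig_poly_prod:
  assumes "finite A" "\<And>a. a \<in> A \<Longrightarrow> trig_poly (k a) (T a)"
  shows "trig_poly (\<Sum>a\<in>A. k a) (\<lambda>\<psi>. \<Prod>a\<in>A. T a \<psi>)"
  using assms
proof (induction A rule: finite_induct)
  case empty
  then show ?case using trig_poly_const[of 1] by simp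
next
  case (insert a A)
  then show ?case by (simp add: trig_poly_mult)
qed

text \<open>The square of a frequency-1/2 function has frequencies at most 1. Hence squared
  coordinates on a great circle have degree 1 in the doubled angle, and \<open>f\<close> keeps its
  degree.\<close>

lemma trig_poly_square_cos_sin:
  "trig_poly 1 (\<lambda>\<psi>. of_real ((cos (\<psi> / 2) * a + sin (\<psi> / 2) * b)\<^sup>2))"
proof (rule trig_polyI)
  let ?Q = "[:Complex ((a\<^sup>2 - b\<^sup>2) / 4) (a * b / 2), of_real ((a\<^sup>2 + b\<^sup>2) / 2), Complex ((a\<^sup>2 - b\<^sup>2) / 4) (- (a * b / 2)):]"
  show "degree ?Q \<le> 2 * 1" by simp
  fix \<psi> :: real
  have c: "cos \<psi> = (cos (\<psi>/2))\<^sup>2 - (sin (\<psi>/2))\<^sup>2" and s: "sin \<psi> = 2 * sin (\<psi>/2) * cos (\<psi>/2)"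
    using cos_double[of "\<psi>/2"] sin_double[of "\<psi>/2"] by auto
  have one: "(cos (\<psi>/2))\<^sup>2 + (sin (\<psi>/2))\<^sup>2 = 1" by simp
  have "(cos (\<psi> / 2) * a + sin (\<psi> / 2) * b)\<^sup>2
    = (a\<^sup>2 + b\<^sup>2) / 2 * ((cos (\<psi>/2))\<^sup>2 + (sin (\<psi>/2))\<^sup>2) + (a\<^sup>2 - b\<^sup>2) / 2 * cos \<psi> + a * b * sin \<psi>"
    unfolding c s by (simp add: field_simps power2_eq_square del: sin_cos_squared_add sin_cos_squared_add2 sin_cos_squared_add3)
  then have eq: "(cos (\<psi> / 2) * a + sin (\<psi> / 2) * b)\<^sup>2
    = (a\<^sup>2 + b\<^sup>2) / 2 + (a\<^sup>2 - b\<^sup>2) / 2 * cos \<psi> + a * b * sin \<psi>" by simp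
  have "cis (- (real 1 * \<psi>)) * poly ?Q (cis \<psi>)
      = Complex ((a\<^sup>2 - b\<^sup>2) / 4) (a * b / 2) * cis (-\<psi>) + of_real ((a\<^sup>2 + b\<^sup>2) / 2) * (cis (-\<psi>) * cis \<psi>)
        + Complex ((a\<^sup>2 - b\<^sup>2) / 4) (- (a * b / 2)) * ((cis (-\<psi>) * cis \<psi>) * cis \<psi>)"
    by (simp add: algebra_simps)
  also have "cis (-\<psi>) * cis \<psi> = 1" by (simp add: cis_mult)
  also have "Complex ((a\<^sup>2 - b\<^sup>2) / 4) (a * b / 2) * cis (-\<psi>) + of_real ((a\<^sup>2 + b\<^sup>2) / 2) * 1
        + Complex ((a\<^sup>2 - b\<^sup>2) / 4) (- (a * b / 2)) * (1 * cis \<psi>) = of_real ((cos (\<psi> / 2) * a + sin (\<psi> / 2) * b)\<^sup>2)"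
    unfolding eq by (simp add: complex_eq_iff)
  finally show "of_real ((cos (\<psi> / 2) * a + sin (\<psi> / 2) * b)\<^sup>2) = cis (- (real 1 * \<psi>)) * poly ?Q (cis \<psi>)" by simp
qed

section \<open>Equally spaced quadrature and the Fejer kernel\<close>

lemma sum_cis_roots:
  assumes "d > 0"
  shows "(\<Sum>k<d. cis (2 * pi * real m * real k / real d)) = (if d dvd m then of_nat d else 0)"
proof -
  define w where "w = cis (2 * pi * real m / real d)"
  have pw: "cis (2 * pi * real m * real k / real d) = w ^ k" for k
    unfolding w_def Complex.DeMoivre by (intro arg_cong[of _ _ cis]) (simp add: mult_ac)
  have wd: "w ^ d = 1"
  proof -
    have "real d * (2 * pi * real m / real d) = 2 * pi * real m" using assms by simp
    then show ?thesis unfolding w_def Complex.DeMoivre by (simp add: cis_multiple_2pi)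
  qed
  show ?thesis
  proof (cases "d dvd m")
    case True
    then obtain q where "m = d * q" by blast
    then have "2 * pi * real m / real d = 2 * pi * real q" using assms by simp
    then have "w = cis (2 * pi * real q)" by (simp only: w_def)
    also have "\<dots> = 1" by (rule cis_multiple_2pi) simp
    finally have "w = 1" .
    with True show ?thesis by (simp add: pw)
  next
    case False
    have "w \<noteq> 1"
    proof
      assume "w = 1"
      then have "cos (2 * pi * real m / real d) = 1" by (simp add: w_def complex_eq_iff)
      then obtain x :: int where "2 * pi * real m / real d = of_int x * 2 * pi"
        using cos_one_2pi_int by blast
      then have "real m = of_int x * real d" using assms by (simp add: field_simps)
      then have "int m = x * int d" by (metis of_int_eq_iff of_int_mult of_int_of_nat_eq)
      then have "int d dvd int m" by simp
      with False show False by simp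
    qed
    with False show ?thesis by (simp add: pw sum_gp_strict wd)
  qed
qed

lemma poly_eq_sum_atMost:
  fixes p :: "'a::comm_semiring_1 poly"
  assumes "degree p \<le> n"
  shows "poly p x = (\<Sum>i\<le>n. coeff p i * x ^ i)"
  unfolding poly_altdef using assms
  by (intro sum.mono_neutral_left) (auto simp: coeff_eq_0)

text \<open>Summation over d equally spaced points kills every frequency that is not a multiple of
  d; among frequencies of modulus below d only the constant term survives, and it does not see the
  shift.\<close>

lemma trig_poly_quadrature:
  assumes "trig_poly (d - 1) R" "d > 0"
  shows "(\<Sum>k<d. R (\<psi> + 2 * pi * real k / real d)) = (\<Sum>k<d. R (\<phi> + 2 * pi * real k / real d))"
proof -
  from assms obtain Q where Q: "degree Q \<le> 2 * (d - 1)"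
      "\<And>\<psi>. R \<psi> = cis (- (real (d - 1) * \<psi>)) * poly Q (cis \<psi>)"
    unfolding trig_poly_def by blast
  have "(\<Sum>k<d. R (\<psi> + 2 * pi * real k / real d)) = of_nat d * coeff Q (d - 1)" for \<psi>
  proof -
    \<comment> \<open>The frequency \<open>m - (d - 1)\<close> may be negative; the natural number
      \<open>m + 1\<close> is congruent to it modulo d.\<close>
    have trm: "cis (- (real (d - 1) * (\<psi> + 2 * pi * real k / real d))) * cis (\<psi> + 2 * pi * real k / real d) ^ m
      = cis ((real m - real (d - 1)) * \<psi>) * cis (2 * pi * real (m + 1) * real k / real d)" for k m
    proof -
      have "cis (- (real (d - 1) * (\<psi> + 2 * pi * real k / real d))) * cis (\<psi> + 2 * pi * real k / real d) ^ m
        = cis ((real m - real (d - 1)) * \<psi> + 2 * pi * real (m + 1) * real k / real d - 2 * pi * real k)"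
        using assms(2) unfolding Complex.DeMoivre cis_mult by (intro arg_cong[of _ _ cis]) (simp add: of_nat_diff field_simps)
      also have "\<dots> = cis ((real m - real (d - 1)) * \<psi>) * cis (2 * pi * real (m + 1) * real k / real d) * cis (2 * pi * - real k)"
        unfolding cis_mult by simp
      also have "cis (2 * pi * - real k) = 1" by (rule cis_multiple_2pi) auto
      finally show ?thesis by simp
    qed
    have "(\<Sum>k<d. R (\<psi> + 2 * pi * real k / real d))
      = (\<Sum>k<d. \<Sum>m\<le>2 * (d - 1). coeff Q m * (cis (- (real (d - 1) * (\<psi> + 2 * pi * real k / real d))) * cis (\<psi> + 2 * pi * real k / real d) ^ m))"
      unfolding Q(2) poly_eq_sum_atMost[OF Q(1)] sum_distrib_left by (simp add: mult_ac)
    also have "\<dots> = (\<Sum>m\<le>2 * (d - 1). coeff Q m * cis ((real m - real (d - 1)) * \<psi>) * (\<Sum>k<d. cis (2 * pi * real (m + 1) * real k / real d)))"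
      unfolding trm by (subst sum.swap) (simp add: sum_distrib_left mult.assoc)
    also have "\<dots> = (\<Sum>m\<le>2 * (d - 1). if m = d - 1 then of_nat d * coeff Q m else 0)"
    proof (intro sum.cong refl)
      fix m assume m: "m \<in> {..2 * (d - 1)}"
      have "d dvd m + 1 \<longleftrightarrow> m = d - 1"
      proof
        assume "d dvd m + 1"
        then obtain q where q: "m + 1 = d * q" by blast
        have "q < 2"
        proof (rule ccontr)
          assume "\<not> q < 2"
          then have "d * 2 \<le> d * q" by (intro mult_le_mono2) simp
          moreover have "m < d * 2 - 1" using m assms(2) by auto
          ultimately show False using q by linarith
        qed
        moreover have "q \<noteq> 0" using q by (cases q) auto
        ultimately have "q = 1" by simp
        with q show "m = d - 1" by simp
      qed (use assms in simp)
      then show "coeff Q m * cis ((real m - real (d - 1)) * \<psi>) * (\<Sum>k<d. cis (2 * pi * real (m + 1) * real k / real d))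
         = (if m = d - 1 then of_nat d * coeff Q m else 0)"
        unfolding sum_cis_roots[OF assms(2)] by auto
    qed
    also have "\<dots> = of_nat d * coeff Q (d - 1)" by simp
    finally show ?thesis .
  qed
  then show ?thesis by simp
qed

lemma cis_minus_one: "cis \<psi> - 1 = 2 * \<i> * of_real (sin (\<psi> / 2)) * cis (\<psi> / 2)"
  using cos_double_sin[of "\<psi>/2"] sin_double[of "\<psi>/2"]
  by (simp add: complex_eq_iff power2_eq_square)

text \<open>F is the unnormalized Fejer kernel, the square of 1 + z + ... + z^(d-1) recentered. That
  geometric sum equals d at 1 and vanishes at the other d-th roots of unity. The second property is
  a product so that it also covers zeros of the sine.\<close>

lemma trig_poly_fejer:
  assumes "d > 0"
  obtains F where "trig_poly (d - 1) F"
    "\<And>\<psi>. of_real ((sin (\<psi> / 2))\<^sup>2) * F \<psi> = of_real ((sin (real d * \<psi> / 2))\<^sup>2)"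
    "(\<Sum>k<d. F (2 * pi * real k / real d)) = of_nat d ^ 2"
proof -
  let ?S = "\<lambda>\<psi>. \<Sum>j<d. cis \<psi> ^ j"
  define F where "F = (\<lambda>\<psi>. cis (- (real (d - 1) * \<psi>)) * (?S \<psi>)\<^sup>2)"
  note half = cis_minus_one
  show ?thesis
  proof
    show "trig_poly (d - 1) F"
    proof (rule trig_polyI)
      have "degree (\<Sum>j<d. monom (1::complex) j) \<le> d - 1"
        by (intro degree_sum_le) (auto simp: degree_monom_eq)
      then show "degree ((\<Sum>j<d. monom (1::complex) j)\<^sup>2) \<le> 2 * (d - 1)"
        using degree_power_le[of "\<Sum>j<d. monom (1::complex) j" 2] by simp
    qed (simp add: F_def poly_sum poly_monom)
    show "of_real ((sin (\<psi> / 2))\<^sup>2) * F \<psi> = of_real ((sin (real d * \<psi> / 2))\<^sup>2)" for \<psi>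
    proof -
      have "(cis \<psi> - 1) * ?S \<psi> = cis \<psi> ^ d - 1"
        by (simp add: power_diff_1_eq)
      then have "(2 * \<i> * of_real (sin (\<psi> / 2)) * cis (\<psi> / 2) * ?S \<psi>)\<^sup>2
         = (2 * \<i> * of_real (sin (real d * \<psi> / 2)) * cis (real d * \<psi> / 2))\<^sup>2"
        using half[of \<psi>] half[of "real d * \<psi>"] by (simp only: Complex.DeMoivre times_divide_eq_right)
      then have "(2 * \<i>)\<^sup>2 * ((of_real (sin (\<psi> / 2)))\<^sup>2 * ((cis (\<psi> / 2))\<^sup>2 * (?S \<psi>)\<^sup>2))
         = (2 * \<i>)\<^sup>2 * ((of_real (sin (real d * \<psi> / 2)))\<^sup>2 * (cis (real d * \<psi> / 2))\<^sup>2)"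
        by (simp only: power_mult_distrib mult.assoc)
      then have eq: "(of_real (sin (\<psi> / 2)))\<^sup>2 * ((cis (\<psi> / 2))\<^sup>2 * (?S \<psi>)\<^sup>2)
         = (of_real (sin (real d * \<psi> / 2)))\<^sup>2 * (cis (real d * \<psi> / 2))\<^sup>2"
        by (subst (asm) mult_left_cancel) (simp, assumption)
      have c1: "(cis (\<psi> / 2))\<^sup>2 = cis \<psi>" "(cis (real d * \<psi> / 2))\<^sup>2 = cis (real d * \<psi>)"
        by (simp_all add: Complex.DeMoivre)
      have "cis (- (real (d - 1) * \<psi>)) = cis (- (real d * \<psi>)) * cis \<psi>"
        unfolding cis_mult using assms by (intro arg_cong[of _ _ cis]) (simp add: of_nat_diff algebra_simps)
      then have "of_real ((sin (\<psi> / 2))\<^sup>2) * F \<psi>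
         = cis (- (real d * \<psi>)) * ((of_real (sin (\<psi> / 2)))\<^sup>2 * ((cis (\<psi> / 2))\<^sup>2 * (?S \<psi>)\<^sup>2))"
        by (simp add: F_def c1)
      also have "\<dots> = (of_real (sin (real d * \<psi> / 2)))\<^sup>2 * (cis (- (real d * \<psi>)) * cis (real d * \<psi>))"
        by (subst eq) (simp add: c1)
      finally show ?thesis by (simp add: cis_mult)
    qed
    have "?S (2 * pi * real k / real d) = (if k = 0 then of_nat d else 0)" if "k < d" for k
    proof -
      have "?S (2 * pi * real k / real d) = (\<Sum>j<d. cis (2 * pi * real k * real j / real d))"
        unfolding Complex.DeMoivre by (simp add: mult_ac)
      also have "\<dots> = (if k = 0 then of_nat d else 0)"
        unfolding sum_cis_roots[OF assms] using that by (auto dest: dvd_imp_le)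
      finally show ?thesis .
    qed
    then have "(\<Sum>k<d. F (2 * pi * real k / real d)) = (\<Sum>k<d. if k = 0 then of_nat d ^ 2 else 0)"
      by (intro sum.cong) (auto simp: F_def)
    then show "(\<Sum>k<d. F (2 * pi * real k / real d)) = of_nat d ^ 2"
      using assms by simp
  qed
qed

text \<open>Writing \<open>h = sin\<^sup>2 (\<psi> / 2) R\<close> with \<open>R \<ge> 0\<close>, the quadrature rule bounds \<open>R\<close> at any
  point by the sum of \<open>R\<close> over the odd multiples of \<open>\<pi> / d\<close>, where \<open>R \<le> 1 / sin\<^sup>2 (\<psi> / 2)\<close>; the
  Fejer kernel shows that these bounds add up to \<open>d\<^sup>2\<close>.\<close>

lemma trig_poly_bound_at_zero:
  fixes h :: "real \<Rightarrow> real"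
  assumes tp: "trig_poly d (\<lambda>\<psi>. of_real (h \<psi>))" and d: "d > 0"
    and h0: "h 0 = 0" and nn: "\<And>\<psi>. 0 \<le> h \<psi>" and le1: "\<And>\<psi>. h \<psi> \<le> 1"
  shows "h \<psi> \<le> (real d)\<^sup>2 * (sin (\<psi> / 2))\<^sup>2"
proof -
  from tp obtain Q where degQ: "degree Q \<le> 2 * d"
    and hQ: "\<And>\<psi>. of_real (h \<psi>) = cis (- (real d * \<psi>)) * poly Q (cis \<psi>)"
    unfolding trig_poly_def by blast
  have Q1: "poly Q 1 = 0" using hQ[of 0] h0 by simp
  \<comment> \<open>A holomorphic extension of \<open>h\<close>, which reduces the derivative at 0
    to \<open>pderiv Q\<close> at 1.\<close>
  define g where "g = (\<lambda>z. exp (- (\<i> * of_nat d * z)) * poly Q (exp (\<i> * z)))"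
  have hg: "of_real (h \<psi>) = g (of_real \<psi>)" for \<psi>
    unfolding hQ g_def by (simp add: cis_conv_exp mult_ac)
  have "(g has_field_derivative \<i> * poly (pderiv Q) 1) (at 0)"
    unfolding g_def by (rule derivative_eq_intros refl | simp add: Q1)+
  then have vd: "((\<lambda>\<psi>. complex_of_real (h \<psi>)) has_vector_derivative (\<i> * poly (pderiv Q) 1)) (at 0)"
    unfolding hg using has_vector_derivative_real_field[of g _ 0] by simp
  have "(h has_real_derivative Re (\<i> * poly (pderiv Q) 1)) (at 0)"
    using bounded_linear.has_vector_derivative[OF bounded_linear_Re vd]
    by (simp add: has_real_derivative_iff_has_vector_derivative)
  \<comment> \<open>\<open>h\<close> has its minimum 0 at 0, so its derivative vanishes there; thus
    1 is a double root of \<open>Q\<close>.\<close>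
  then have re: "Re (\<i> * poly (pderiv Q) 1) = 0"
    by (rule DERIV_local_min[of _ _ _ 1]) (simp_all add: h0 nn)
  have "((\<lambda>_. 0) has_real_derivative Im (\<i> * poly (pderiv Q) 1)) (at 0)"
    using bounded_linear.has_vector_derivative[OF bounded_linear_Im vd]
    by (simp add: has_real_derivative_iff_has_vector_derivative)
  then have im: "Im (\<i> * poly (pderiv Q) 1) = 0"
    using DERIV_const DERIV_unique by blast
  from re im have dQ1: "poly (pderiv Q) 1 = 0" by (simp add: complex_eq_iff)
  from Q1 obtain Qa where Qa: "Q = [:-1, 1:] * Qa" by (auto simp: poly_eq_0_iff_dvd)
  have "poly Qa 1 = 0" using dQ1 unfolding Qa pderiv_mult by (simp add: pderiv_pCons)
  then obtain Qb where Qb: "Qa = [:-1, 1:] * Qb" by (auto simp: poly_eq_0_iff_dvd)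
  have degQb: "degree Qb \<le> 2 * (d - 1)"
  proof (cases "Qb = 0")
    case False
    then have "degree Q = 2 + degree Qb" unfolding Qa Qb by (simp add: degree_mult_eq del: mult_pCons_left)
    with degQ show ?thesis by simp
  qed simp
  \<comment> \<open>The factor -4 comes from (z - 1)^2 = -4 sin^2 (\<psi> / 2) z on the unit
    circle.\<close>
  define R where "R = (\<lambda>\<psi>. cis (- (real (d - 1) * \<psi>)) * poly (smult (- 4) Qb) (cis \<psi>))"
  have tpR: "trig_poly (d - 1) R"
    by (rule trig_polyI[of "smult (- 4) Qb"]) (use degQb in \<open>auto simp: R_def\<close>)
  have hR: "of_real (h \<psi>) = of_real ((sin (\<psi> / 2))\<^sup>2) * R \<psi>" for \<psi>
  proof -
    have "of_real (h \<psi>) = cis (- (real d * \<psi>)) * (cis \<psi> - 1)\<^sup>2 * poly Qb (cis \<psi>)"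
      unfolding hQ Qa Qb by (simp add: power2_eq_square algebra_simps)
    also have "(cis \<psi> - 1)\<^sup>2 = - 4 * of_real ((sin (\<psi> / 2))\<^sup>2) * cis \<psi>"
      unfolding cis_minus_one by (simp add: power_mult_distrib Complex.DeMoivre)
    also have "cis (- (real d * \<psi>)) * (- 4 * of_real ((sin (\<psi> / 2))\<^sup>2) * cis \<psi>)
        = of_real ((sin (\<psi> / 2))\<^sup>2) * (- 4) * (cis (- (real d * \<psi>)) * cis \<psi>)" by simp
    also have "cis (- (real d * \<psi>)) * cis \<psi> = cis (- (real (d - 1) * \<psi>))"
      unfolding cis_mult using d by (intro arg_cong[of _ _ cis]) (simp add: of_nat_diff algebra_simps)
    finally show ?thesis by (simp add: R_def)
  qed
  define G where "G = (\<lambda>\<psi>. Re (R \<psi>))"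
  have hG: "h \<psi> = (sin (\<psi> / 2))\<^sup>2 * G \<psi>" for \<psi>
    using arg_cong[OF hR[of \<psi>], of Re] by (simp add: G_def)
  have Gnn: "G \<psi> \<ge> 0" if "sin (\<psi> / 2) \<noteq> 0" for \<psi>
    using nn[of \<psi>] that unfolding hG by (simp add: zero_le_mult_iff)
  \<comment> \<open>The zeros of \<open>sin (\<psi> / 2)\<close> are isolated, so continuity extends
    nonnegativity to them.\<close>
  have Gnn: "G \<psi> \<ge> 0" for \<psi>
  proof (cases "sin (\<psi> / 2) = 0")
    case True
    have "continuous_on UNIV G"
      unfolding G_def R_def cis_conv_exp by (intro continuous_intros)
    then have "(G \<longlongrightarrow> G \<psi>) (at \<psi>)" by (simp add: continuous_on_def)
    moreover have "\<forall>\<^sub>F \<phi> in at \<psi>. 0 \<le> G \<phi>"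
      unfolding eventually_at
    proof (intro exI[of _ 1] conjI ballI impI)
      fix \<phi> assume *: "\<phi> \<noteq> \<psi> \<and> dist \<phi> \<psi> < 1"
      have "sin (\<phi> / 2) = cos (\<psi> / 2) * sin ((\<phi> - \<psi>) / 2)"
        using sin_add[of "(\<phi> - \<psi>) / 2" "\<psi> / 2"] True by (simp add: field_simps)
      moreover have "cos (\<psi> / 2) \<noteq> 0" using True sin_cos_squared_add[of "\<psi> / 2"] by auto
      moreover have "sin ((\<phi> - \<psi>) / 2) \<noteq> 0"
      proof -
        have "- pi < (\<phi> - \<psi>) / 2" "(\<phi> - \<psi>) / 2 < pi" "(\<phi> - \<psi>) / 2 \<noteq> 0"
          using * pi_gt3 unfolding dist_real_def by (simp_all add: abs_less_iff)
        then show ?thesis using sin_eq_0_pi by blast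
      qed
      ultimately show "0 \<le> G \<phi>" by (intro Gnn) simp
    qed simp
    ultimately show ?thesis by (intro tendsto_lowerbound) auto
  qed (rule Gnn)
  obtain F where F: "trig_poly (d - 1) F"
    "\<And>\<psi>. of_real ((sin (\<psi> / 2))\<^sup>2) * F \<psi> = of_real ((sin (real d * \<psi> / 2))\<^sup>2)"
    "(\<Sum>k<d. F (2 * pi * real k / real d)) = of_nat d ^ 2"
    using trig_poly_fejer[OF d] by metis
  \<comment> \<open>The point itself is the node \<open>k = 0\<close>, and all other terms are
    nonnegative.\<close>
  have "G \<psi> \<le> (\<Sum>k<d. G (\<psi> + 2 * pi * real k / real d))"
    using member_le_sum[of 0 "{..<d}" "\<lambda>k. G (\<psi> + 2 * pi * real k / real d)"] d Gnn by simp
  also have "\<dots> = (\<Sum>k<d. G (pi / real d + 2 * pi * real k / real d))"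
    using arg_cong[OF trig_poly_quadrature[OF tpR d, of \<psi> "pi / real d"], of Re] by (simp add: G_def)
  also have "\<dots> \<le> (\<Sum>k<d. Re (F (pi / real d + 2 * pi * real k / real d)))"
  proof (intro sum_mono)
    fix k
    define \<phi> where "\<phi> = pi / real d + 2 * pi * real k / real d"
    have "real d * \<phi> / 2 = pi / 2 + real k * pi" using d by (simp add: \<phi>_def field_simps)
    then have "sin (real d * \<phi> / 2) = (- 1) ^ k" by (simp only: sin_add) simp
    then have one: "(sin (real d * \<phi> / 2))\<^sup>2 = 1" by (simp add: power_mult[symmetric] mult.commute)
    have "(sin (\<phi> / 2))\<^sup>2 * Re (F \<phi>) = 1"
      using arg_cong[OF F(2)[of \<phi>], of Re] one by simp
    moreover from this have "(sin (\<phi> / 2))\<^sup>2 > 0" by (metis mult_zero_left zero_neq_one zero_less_power2 power_zero_numeral)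
    moreover have "(sin (\<phi> / 2))\<^sup>2 * G \<phi> \<le> 1" using le1[of \<phi>] by (simp add: hG)
    ultimately have "(sin (\<phi> / 2))\<^sup>2 * G \<phi> \<le> (sin (\<phi> / 2))\<^sup>2 * Re (F \<phi>)" by simp
    then show "G \<phi> \<le> Re (F \<phi>)"
      using \<open>(sin (\<phi> / 2))\<^sup>2 > 0\<close> by (simp only: mult_le_cancel_left_pos)
  qed
  \<comment> \<open>The quadrature rule, now for the Fejer kernel, moves the nodes to the multiples
    of \<open>2 * pi / d\<close>, where its sum is known.\<close>
  also have "\<dots> = Re (\<Sum>k<d. F (0 + 2 * pi * real k / real d))"
    unfolding trig_poly_quadrature[OF F(1) d, of 0 "pi / real d"] by simp
  also have "\<dots> = (real d)\<^sup>2" using F(3) by (simp flip: of_nat_power)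
  finally show ?thesis unfolding hG by (simp add: mult.commute mult_right_mono)
qed

subsection \<open>An extremal problem for a Jacobi weight\<close>

text \<open>\<open>L\<close> is integration against the probability density proportional to
  \<open>s\<^sup>-\<^sup>1\<^sup>/\<^sup>2 (1 - s)\<^sup>a\<^sup>-\<^sup>1\<close> on \<open>[0, 1]\<close>. The polynomial that makes \<open>L (Y * P\<^sup>2)\<close> small compared to \<open>L (P\<^sup>2)\<close> is
  the Jacobi polynomial for the weight with two additional factors \<open>Y = 1 - s\<close>: with fewer, \<open>P\<^sup>2\<close> is
  not concentrated enough near \<open>s = 1\<close> for a ratio of order \<open>1 / r\<^sup>2\<close>.\<close>

locale jacobi_functional =
  fixes a :: real and L :: "real poly \<Rightarrow> real"
  assumes a_pos: "a > 0"
    and L_add: "L (p + q) = L p + L q"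
    and L_smult: "L (smult c p) = c * L p"
    and L_moment: "L (monom 1 m) = pochhammer (1 / 2) m / pochhammer (a + 1 / 2) m"
    and L_pos: "p \<noteq> 0 \<Longrightarrow> L (p\<^sup>2) > 0"
begin

lemma L_zero: "L 0 = 0"
  using L_smult[of 0 0] by simp

lemma L_minus: "L (- p) = - L p"
  using L_smult[of "-1" p] by simp

lemma L_diff: "L (p - q) = L p - L q"
  using L_add[of p "- q"] by (simp add: L_minus)

lemma L_const_mult: "L ([:c:] * p) = c * L p"
  using L_smult[of c p] by simp

lemma L_sum: "finite A \<Longrightarrow> L (\<Sum>i\<in>A. p i) = (\<Sum>i\<in>A. L (p i))"
  by (induction A rule: finite_induct) (auto simp: L_zero L_add)

definition X :: "real poly" where "X = [:0, 1:]"
definition Y :: "real poly" where "Y = [:1, -1:]"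

lemma pderiv_Y: "pderiv Y = - 1"
  by (simp add: Y_def pderiv_pCons one_pCons)

lemma X_eq: "X = 1 - Y"
  by (simp add: X_def Y_def one_pCons)

text \<open>The derivative of s^(1/2) (1 - s)^a p(s) has integral 0, and dividing it by s^(-1/2) (1
  - s)^(a-1) gives this polynomial. On monomials it is the recursion between consecutive
  moments.\<close>

lemma integration_by_parts: "L (([:1 / 2:] - [:a + 1 / 2:] * X) * p + X * Y * pderiv p) = 0"
proof -
  define \<Phi> where "\<Phi> p = L (([:1 / 2:] - [:a + 1 / 2:] * X) * p + X * Y * pderiv p)" for p
  have \<Phi>_add: "\<Phi> (p + q) = \<Phi> p + \<Phi> q" for p q
    unfolding \<Phi>_def L_add[symmetric] by (simp add: pderiv_add algebra_simps del: mult_pCons_left mult_pCons_right)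
  have \<Phi>_sum: "\<Phi> (\<Sum>i\<in>A. q i) = (\<Sum>i\<in>A. \<Phi> (q i))" if "finite A" for A :: "nat set" and q
    using that by (induction A rule: finite_induct) (auto simp: \<Phi>_add, simp add: \<Phi>_def L_zero)
  have "\<Phi> (monom c m) = 0" for c m
  proof -
    have eq: "([:1 / 2:] - [:a + 1 / 2:] * X) * monom c m + X * Y * pderiv (monom c m)
       = smult (c * (1 / 2 + real m)) (monom 1 m) - smult (c * (a + 1 / 2 + real m)) (monom 1 (Suc m))"
    proof (rule poly_eqI)
      fix k
      have e1: "([:1 / 2:] - [:a + 1 / 2:] * X) * monom c m = monom (c / 2) m - monom (c * (a + 1/2)) (Suc m)"
        by (rule poly_eqI) (auto simp: X_def left_diff_distrib monom_Suc[symmetric] smult_monom algebra_simps)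
      have e2: "X * Y * pderiv (monom c m) = monom (c * m) m - monom (c * m) (Suc m)"
      proof -
        have XY: "X * Y * q = pCons 0 q - pCons 0 (pCons 0 q)" for q
          by (simp add: X_def Y_def algebra_simps)
        show ?thesis unfolding XY
          by (cases m) (simp_all add: pderiv_monom monom_Suc[symmetric] mult.commute)
      qed
      show "coeff (([:1 / 2:] - [:a + 1 / 2:] * X) * monom c m + X * Y * pderiv (monom c m)) k
       = coeff (smult (c * (1 / 2 + real m)) (monom 1 m) - smult (c * (a + 1 / 2 + real m)) (monom 1 (Suc m))) k"
        unfolding e1 e2 by (auto simp: algebra_simps)
    qed
    have nz: "pochhammer (a + 1 / 2) m \<noteq> 0" "a + 1 / 2 + real m \<noteq> 0"
      using a_pos pochhammer_pos[of "a + 1 / 2" m] by auto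
    have "c * x * (h / D) - c * E * (h * x / (D * E)) = 0" if "D \<noteq> 0" "E \<noteq> 0" for x h D E :: real
      using that by (simp add: field_simps)
    from this[OF nz] show ?thesis
      unfolding \<Phi>_def eq L_diff L_smult L_moment pochhammer_Suc .
  qed
  then have "\<Phi> (\<Sum>i\<le>degree p. monom (coeff p i) i) = 0"
    by (simp add: \<Phi>_sum)
  then show ?thesis unfolding poly_as_sum_of_monoms \<Phi>_def .
qed

text \<open>The hypergeometric equation with parameters -r, r + a + 3/2 and 1/2. Its polynomial
  solution is the Jacobi polynomial for the weight s^(-1/2) (1 - s)^(a+1), that is, for
  \<open>L\<close> with the factor \<open>Y\<^sup>2\<close>.\<close>

context
  fixes r :: nat and lam :: real and P :: "real poly"
  assumes r_pos: "r > 0" and lam: "lam = real r * (real r + a + 3 / 2)"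
    and deg_P: "degree P = r"
    and ode: "X * Y * pderiv (pderiv P) + ([:1 / 2:] - [:a + 5 / 2:] * X) * pderiv P + [:lam:] * P = 0"
begin

text \<open>The operator is symmetric for the form \<open>L (Y\<^sup>2 * F * G)\<close>: the
  difference of the two sides is what integration by parts makes of \<open>Y\<^sup>2\<close> times a
  Wronskian. It annihilates \<open>P\<close>, so only the side acting on \<open>G\<close>
  remains.\<close>

lemma symmetric: "L (Y\<^sup>2 * P * (X * Y * pderiv (pderiv G) + ([:1 / 2:] - [:a + 5 / 2:] * X) * pderiv G + [:lam:] * G)) = 0"
proof -
  let ?W = "pderiv P * G - P * pderiv G"
  let ?D = "\<lambda>F. X * Y * pderiv (pderiv F) + ([:1 / 2:] - [:a + 5 / 2:] * X) * pderiv F"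
  \<comment> \<open>The additional 2 comes from differentiating \<open>Y\<^sup>2\<close>.\<close>
  have c: "[:a + 5 / 2:] = [:a + 1 / 2:] + 2" by (simp add: numeral_poly)
  have "([:1 / 2:] - [:a + 1 / 2:] * X) * (Y\<^sup>2 * ?W) + X * Y * pderiv (Y\<^sup>2 * ?W)
     = Y\<^sup>2 * (?D P * G - P * ?D G)"
    unfolding c
    by (simp add: pderiv_mult pderiv_diff pderiv_Y power2_eq_square algebra_simps del: mult_pCons_left mult_pCons_right add_pCons)
  also have "?D P = - [:lam:] * P" using ode by (simp only: add_eq_0_iff2 minus_mult_left)
  also have "Y\<^sup>2 * (- [:lam:] * P * G - P * ?D G) = - (Y\<^sup>2 * P * (?D G + [:lam:] * G))"
    by (simp add: algebra_simps del: mult_pCons_left mult_pCons_right add_pCons minus_pCons)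
  finally show ?thesis using integration_by_parts[of "Y\<^sup>2 * ?W"] by (simp add: L_minus)
qed

text \<open>The operator is triangular on monomials, with diagonal entry \<open>lam - lj\<close> and
  one term of degree j - 1. The values \<open>lj\<close> increase strictly with j, so the entry is
  nonzero for \<open>j < r\<close>, and the induction hypothesis removes the lower term.\<close>

lemma orthogonal_monom: "j < r \<Longrightarrow> L (Y\<^sup>2 * P * monom 1 j) = 0"
proof (induction j rule: less_induct)
  case (less j)
  define lj where "lj = real j * (real j + a + 3 / 2)"
  have "X * Y * pderiv (pderiv (monom 1 j)) + ([:1 / 2:] - [:a + 5 / 2:] * X) * pderiv (monom 1 j) + [:lam:] * monom 1 j
     = smult (lam - lj) (monom 1 j) + smult (real j * (real j - 1 / 2)) (monom 1 (j - 1))"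
  proof -
    have XY: "X * Y * q = pCons 0 q - pCons 0 (pCons 0 q)" for q by (simp add: X_def Y_def algebra_simps)
    have Xq: "[:c:] * X * q = smult c (pCons 0 q)" for c q by (simp add: X_def)
    consider "j = 0" | "j = 1" | k where "j = Suc (Suc k)" by (metis One_nat_def not0_implies_Suc)
    then show ?thesis
    proof cases
      case 3
      have "coeff (X * Y * pderiv (pderiv (monom 1 j)) + ([:1 / 2:] - [:a + 5 / 2:] * X) * pderiv (monom 1 j) + [:lam:] * monom 1 j) i
        = coeff (smult (lam - lj) (monom 1 j) + smult (real j * (real j - 1 / 2)) (monom 1 (j - 1))) i" for i
        unfolding XY left_diff_distrib Xq
        by (auto simp: 3 lj_def pderiv_monom monom_Suc[symmetric] smult_monom field_simps)
      then show ?thesis by (rule poly_eqI)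
    qed (simp_all add: XY Xq left_diff_distrib pderiv_monom lj_def monom_Suc one_pCons X_def Y_def pderiv_pCons algebra_simps)
  qed
  from symmetric[of "monom 1 j", unfolded this]
  have "(lam - lj) * L (Y\<^sup>2 * P * monom 1 j) + (real j * (real j - 1 / 2)) * L (Y\<^sup>2 * P * monom 1 (j - 1)) = 0"
    by (simp add: distrib_left L_add L_smult)
  moreover have "real j * (real j - 1 / 2) * L (Y\<^sup>2 * P * monom 1 (j - 1)) = 0"
    using less by (cases j) auto
  moreover have "lj < lam" unfolding lj_def lam
    using less.prems a_pos by (intro mult_strict_mono) auto
  ultimately have "(lam - lj) * L (Y\<^sup>2 * P * monom 1 j) = 0" "lj < lam" by linarith+
  then show ?case by simp
qed

lemma orthogonal:
  assumes "degree G < r"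
  shows "L (Y\<^sup>2 * P * G) = 0"
proof -
  have "L (Y\<^sup>2 * P * (\<Sum>i\<le>degree G. smult (coeff G i) (monom 1 i))) = 0"
    using assms by (simp add: sum_distrib_left L_sum L_smult orthogonal_monom)
  then show ?thesis by (simp add: smult_monom poly_as_sum_of_monoms)
qed

text \<open>Expanding one factor \<open>P\<close> in powers of \<open>Y\<close>, orthogonality leaves at most two terms of each of
  \<open>L (P\<^sup>2)\<close> and \<open>L (Y * P\<^sup>2)\<close>, and the differential equation determines their quotients.\<close>

lemma ratio:
  "L (P\<^sup>2) = (1 + 1 / (2 * a) + 2 * lam / (a * (a + 2))) * L (Y * P\<^sup>2)"
proof -
  \<comment> \<open>Division by \<open>Y\<close> with remainder; used twice, it gives the first two
    coefficients \<open>p0\<close> and \<open>p1\<close> of \<open>P\<close> in powers of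
    \<open>Y\<close>.\<close>
  have split: "\<exists>R. p = [:poly p 1:] + Y * R" for p
  proof -
    have "[:-1, 1:] dvd p - [:poly p 1:]" by (simp add: poly_eq_0_iff_dvd[symmetric])
    then obtain R where "p - [:poly p 1:] = [:-1, 1:] * R" by blast
    then have "p = [:poly p 1:] + Y * (- R)" by (simp add: Y_def algebra_simps)
    then show ?thesis by blast
  qed
  define p0 where "p0 = poly P 1"
  obtain R1 where R1: "P = [:p0:] + Y * R1" using split[of P] p0_def by blast
  define p1 where "p1 = poly R1 1"
  obtain R2 where R2: "R1 = [:p1:] + Y * R2" using split[of R1] p1_def by blast
  have dY: "degree (Y * R) = Suc (degree R)" if "R \<noteq> 0" for R
    using that by (subst degree_mult_eq) (auto simp: Y_def)
  have d1: "degree R1 < r"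
  proof (cases "R1 = 0")
    case False
    have "Y * R1 = P - [:p0:]" using R1 by simp
    then have "degree (Y * R1) \<le> r" using deg_P by (metis degree_diff_le degree_pCons_0 le0 order_refl)
    then show ?thesis using dY[OF False] by simp
  qed (use r_pos in simp)
  have d2: "degree R2 < r"
  proof (cases "R2 = 0")
    case False
    have "Y * R2 = R1 - [:p1:]" using R2 by simp
    then have "degree (Y * R2) \<le> r" using d1 by (metis degree_diff_le degree_pCons_0 le0 less_imp_le)
    then show ?thesis using dY[OF False] by simp
  qed (use r_pos in simp)
  define B0 B1 where "B0 = L P" and "B1 = L (Y * P)"
  have "Y * P\<^sup>2 = [:p0:] * (Y * P) + Y\<^sup>2 * P * R1"
  proof -
    have "Y * P\<^sup>2 = Y * (P * ([:p0:] + Y * R1))" using R1 by (simp add: power2_eq_square)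
    then show ?thesis by (simp add: power2_eq_square algebra_simps del: mult_pCons_left mult_pCons_right add_pCons)
  qed
  then have A1: "L (Y * P\<^sup>2) = p0 * B1"
    by (simp only: L_add L_const_mult orthogonal[OF d1] B1_def)
  have "P\<^sup>2 = P * ([:p0:] + Y * ([:p1:] + Y * R2))"
    using R1 R2 by (simp add: power2_eq_square)
  also have "\<dots> = [:p0:] * P + [:p1:] * (Y * P) + Y\<^sup>2 * P * R2"
    by (simp add: power2_eq_square algebra_simps del: mult_pCons_left mult_pCons_right add_pCons)
  finally have A0: "L (P\<^sup>2) = p0 * B0 + p1 * B1"
    by (simp only: L_add L_const_mult orthogonal[OF d2] B1_def B0_def)
  have "pderiv P = - R1 + Y * pderiv R1"
    by (subst R1) (simp add: pderiv_add pderiv_mult pderiv_Y pderiv_pCons)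
  then have "poly (pderiv P) 1 = - p1" by (simp add: p1_def Y_def)
  \<comment> \<open>At s = 1 the second-order term drops out because \<open>Y\<close> vanishes,
    which leaves a linear relation between \<open>p0\<close> and \<open>p1\<close>.\<close>
  with arg_cong[OF ode, of "\<lambda>q. poly q 1"] have p1: "(a + 2) * p1 + lam * p0 = 0"
    by (simp add: X_def Y_def p0_def algebra_simps)
  \<comment> \<open>Integration by parts for \<open>Y * pderiv P\<close>, and below for
    \<open>P\<close>, gives the linear relation between \<open>B0\<close> and
    \<open>B1\<close>.\<close>
  have "L (X * Y * pderiv P) = lam * B1"
  proof -
    have c: "[:a + 5 / 2:] = [:a + 1 / 2:] + 2" by (simp add: numeral_poly)
    have "([:1 / 2:] - [:a + 1 / 2:] * X) * (Y * pderiv P) + X * Y * pderiv (Y * pderiv P)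
      = Y * (X * Y * pderiv (pderiv P) + ([:1 / 2:] - [:a + 5 / 2:] * X) * pderiv P + [:lam:] * P) + X * Y * pderiv P - [:lam:] * (Y * P)"
      unfolding c
      by (simp add: pderiv_mult pderiv_Y algebra_simps del: mult_pCons_left mult_pCons_right add_pCons)
    with integration_by_parts[of "Y * pderiv P"] show ?thesis
      unfolding ode by (simp only: L_diff L_const_mult B1_def mult_zero_right add_0)
  qed
  moreover have "([:1 / 2:] - [:a + 1 / 2:] * X) * P + X * Y * pderiv P = [:a + 1/2:] * (Y * P) - [:a:] * P + X * Y * pderiv P"
    
  proof -
    have c: "[:a + 1 / 2:] = [:a:] + [:1 / 2:]" by simp
    show ?thesis unfolding c unfolding X_eq
      by (simp add: algebra_simps del: mult_pCons_left mult_pCons_right add_pCons minus_pCons)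
  qed
  ultimately have B: "(a + 1 / 2) * B1 - a * B0 + lam * B1 = 0"
    using integration_by_parts[of P] by (simp only: L_add L_diff L_const_mult B1_def B0_def)
  have b0: "B0 = (lam + a + 1 / 2) * B1 / a" using B a_pos by (simp add: field_simps)
  have p1': "p1 = - lam * p0 / (a + 2)" using p1 a_pos by (simp add: field_simps)
  have "a \<noteq> 0" "a + 2 \<noteq> 0" using a_pos by auto
  then show ?thesis unfolding A0 A1 b0 p1' by (simp add: divide_simps) (simp add: algebra_simps)
qed

end

text \<open>Power series coefficients of the hypergeometric solution. The factor with
  \<open>i = r\<close> is zero and the earlier ones are not, so the series stops exactly at degree
  r.\<close>

definition jacobi_coeff :: "nat \<Rightarrow> nat \<Rightarrow> real" where
  "jacobi_coeff r k = (\<Prod>i<k. (real i * (real i + a + 3 / 2) - real r * (real r + a + 3 / 2)) / ((real i + 1) * (real i + 1 / 2)))"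

lemma jacobi_ode:
  obtains P where "degree P = r"
    "X * Y * pderiv (pderiv P) + ([:1 / 2:] - [:a + 5 / 2:] * X) * pderiv P
       + [:real r * (real r + a + 3 / 2):] * P = 0"
proof
  let ?c = "jacobi_coeff r" and ?lam = "\<lambda>k. real k * (real k + a + 3 / 2)"
  define P where "P = (\<Sum>k\<le>r. monom (?c k) k)"
  have c_Suc: "?c (Suc k) * ((real k + 1) * (real k + 1 / 2)) = ?c k * (?lam k - ?lam r)" for k
    by (simp add: jacobi_coeff_def add_pos_pos less_imp_neq[THEN not_sym])
  have c_nz: "?c k \<noteq> 0" if "k \<le> r" for k
  proof -
    have "?lam i < ?lam r" if "i < k" for i
      using that \<open>k \<le> r\<close> a_pos by (intro mult_strict_mono) auto
    then show ?thesis unfolding jacobi_coeff_def by (fastforce simp: add_nonneg_eq_0_iff)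
  qed
  have c_0: "?c k = 0" if "k > r" for k
    using that unfolding jacobi_coeff_def by auto
  have coeff_P: "coeff P k = ?c k" for k
    using c_0 by (auto simp: P_def coeff_sum not_le)
  show "degree P = r"
  proof (rule antisym)
    show "degree P \<le> r" by (rule degree_le) (simp add: coeff_P c_0)
    show "r \<le> degree P" by (rule le_degree) (simp add: coeff_P c_nz)
  qed
  have XY: "X * Y * q = pCons 0 q - pCons 0 (pCons 0 q)" for q by (simp add: X_def Y_def algebra_simps)
  have Xq: "[:c:] * X * q = smult c (pCons 0 q)" for c q by (simp add: X_def)
  show "X * Y * pderiv (pderiv P) + ([:1 / 2:] - [:a + 5 / 2:] * X) * pderiv P + [:?lam r:] * P = 0"
  proof (rule poly_eqI)
    fix k
    have "coeff (X * Y * pderiv (pderiv P) + ([:1 / 2:] - [:a + 5 / 2:] * X) * pderiv P + [:?lam r:] * P) k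
      = ?c (Suc k) * ((real k + 1) * (real k + 1 / 2)) - ?c k * (?lam k - ?lam r)"
      unfolding XY left_diff_distrib Xq
      by (cases k; cases "k - 1") (auto simp: coeff_pderiv coeff_P coeff_pCons field_simps)
    then show "coeff (X * Y * pderiv (pderiv P) + ([:1 / 2:] - [:a + 5 / 2:] * X) * pderiv P + [:?lam r:] * P) k = coeff 0 k"
      by (simp add: c_Suc)
  qed
qed

text \<open>The quotient in \<open>ratio\<close> is at least
  \<open>2 * r\<^sup>2 / (a * (a + 2))\<close> because \<open>lam\<close> is at least
  \<open>r\<^sup>2\<close>; the solution is then scaled to unit norm.\<close>

lemma jacobi_kernel:
  assumes "r > 0"
  obtains P where "degree P \<le> r" "L (P\<^sup>2) = 1" "L (Y * P\<^sup>2) \<le> a * (a + 2) / (2 * (real r)\<^sup>2)"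
proof -
  define lam where "lam = real r * (real r + a + 3 / 2)"
  obtain P where P: "degree P = r"
    "X * Y * pderiv (pderiv P) + ([:1 / 2:] - [:a + 5 / 2:] * X) * pderiv P + [:lam:] * P = 0"
    using jacobi_ode[of r] unfolding lam_def by blast
  define K where "K = 1 + 1 / (2 * a) + 2 * lam / (a * (a + 2))"
  define c where "c = 1 / sqrt (L (P\<^sup>2))"
  have "P \<noteq> 0" using P(1) assms by auto
  then have pos: "L (P\<^sup>2) > 0" by (rule L_pos)
  have rat: "L (P\<^sup>2) = K * L (Y * P\<^sup>2)"
    unfolding K_def by (rule ratio[OF assms lam_def P])
  have sq: "(smult c P)\<^sup>2 = smult (c\<^sup>2) (P\<^sup>2)" by (simp add: power2_eq_square)
  have c2: "c\<^sup>2 = 1 / L (P\<^sup>2)" using pos by (simp add: c_def power_divide)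
  have "(real r)\<^sup>2 \<le> lam" using a_pos by (simp add: lam_def power2_eq_square distrib_left)
  then have "2 * (real r)\<^sup>2 / (a * (a + 2)) \<le> 2 * lam / (a * (a + 2))"
    using a_pos by (intro divide_right_mono) auto
  also have "\<dots> \<le> K" using a_pos by (simp add: K_def)
  finally have K: "2 * (real r)\<^sup>2 / (a * (a + 2)) \<le> K" .
  moreover have "2 * (real r)\<^sup>2 / (a * (a + 2)) > 0" using a_pos assms by simp
  ultimately have "1 / K \<le> 1 / (2 * (real r)\<^sup>2 / (a * (a + 2)))"
    by (intro divide_left_mono mult_pos_pos) auto
  then have K': "1 / K \<le> a * (a + 2) / (2 * (real r)\<^sup>2)" by simp
  show thesis
  proof (rule that[of "smult c P"])
    show "degree (smult c P) \<le> r" using P(1) degree_smult_le[of c P] by simp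
    show "L ((smult c P)\<^sup>2) = 1" unfolding sq L_smult c2 using pos by simp
    have "L (Y * (smult c P)\<^sup>2) = 1 / K"
      unfolding sq mult_smult_right L_smult c2 using rat pos by (auto simp: divide_simps)
    with K' show "L (Y * (smult c P)\<^sup>2) \<le> a * (a + 2) / (2 * (real r)\<^sup>2)" by simp
  qed
qed

end

subsection \<open>Moments of random signed sums\<close>

definition sgn_of :: "'a set \<Rightarrow> 'a \<Rightarrow> real" where
  "sgn_of E j = (if j \<in> E then - 1 else 1)"

lemma fps_exp_prod:
  "finite A \<Longrightarrow> (\<Prod>x\<in>A. fps_exp (c x)) = fps_exp (\<Sum>x\<in>A. c x :: real)"
  by (induction A rule: finite_induct) (auto simp: fps_exp_add_mult)

lemma prod_add_signs:
  fixes f :: "real \<Rightarrow> 'a::finite \<Rightarrow> 'b::comm_semiring_1"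
  shows "(\<Prod>j\<in>UNIV. f (- 1) j + f 1 j) = (\<Sum>E\<in>UNIV. \<Prod>j\<in>UNIV. f (sgn_of E j) j)"
proof -
  have "(\<Prod>j\<in>UNIV. f (sgn_of E j) j) = (\<Prod>j\<in>E. f (- 1) j) * (\<Prod>j\<in>UNIV - E. f 1 j)" for E
    by (subst prod.subset_diff[of E]) (auto simp: sgn_of_def mult.commute)
  then show ?thesis by (simp add: prod_add)
qed

text \<open>Generating functions: the exponentials of all signed sums add up to the product of
  \<open>exp (- w j X) + exp (w j X)\<close>, and both sides are its coefficients of degree M.
  Multisets encode exponent vectors; odd multiplicities cancel.\<close>

lemma sum_signs_power:
  fixes w :: "'a::finite \<Rightarrow> real"
  shows "(\<Sum>E\<in>UNIV. (\<Sum>j\<in>UNIV. sgn_of E j * w j) ^ M) / fact M =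
    (\<Sum>Z\<in>multisets_of_size UNIV M. \<Prod>j\<in>UNIV. (1 + (- 1) ^ count Z j) * w j ^ count Z j / fact (count Z j))"
proof -
  have "(\<Sum>E\<in>UNIV. \<Prod>j\<in>UNIV. fps_exp (sgn_of E j * w j))
      = (\<Prod>j\<in>UNIV. fps_exp (- 1 * w j) + fps_exp (1 * w j))"
    using prod_add_signs[of "\<lambda>s j. fps_exp (s * w j)"] by simp
  from arg_cong[OF this, of "\<lambda>F. fps_nth F M"] show ?thesis
    by (simp add: fps_exp_prod fps_sum_nth sum_divide_distrib fps_prod_nth' add_divide_distrib[symmetric]
        power_minus[of "w _"] algebra_simps)
qed

text \<open>Coefficient of degree 2 m in the product of the series
  \<open>exp (c j X\<^sup>2)\<close>. It resums the even terms left by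
  \<open>sum_signs_power\<close>.\<close>

lemma sum_multisets_half_exp:
  fixes c :: "'a::finite \<Rightarrow> real"
  shows "(\<Sum>Z\<in>multisets_of_size UNIV (2 * m). \<Prod>j\<in>UNIV. if even (count Z j) then c j ^ (count Z j div 2) / fact (count Z j div 2) else 0)
    = (\<Sum>j\<in>UNIV. c j) ^ m / fact m"
proof -
  let ?E = "\<lambda>c::real. fps_exp c oo fps_X\<^sup>2"
  have nth: "fps_nth (?E c) k = (if even k then c ^ (k div 2) / fact (k div 2) else 0)" for c k
    by (simp add: fps_nth_compose_X_power)
  have "(\<Prod>j\<in>A. ?E (c j)) = ?E (\<Sum>j\<in>A. c j)" if "finite A" for A
    using that by (induction A rule: finite_induct) (auto simp: fps_exp_add_mult fps_compose_mult_distrib)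
  from arg_cong[OF this[of UNIV], of "\<lambda>F. fps_nth F (2 * m)"] show ?thesis
    by (simp add: fps_prod_nth' nth)
qed

text \<open>Orthogonality of the characters of the group of sign changes: the sum factors over
  coordinates, and one lying in exactly one of A and B contributes -1 + 1.\<close>

lemma sum_signs_prod:
  fixes A B :: "'a::finite set"
  shows "(\<Sum>E\<in>UNIV. (\<Prod>j\<in>A. sgn_of E j) * (\<Prod>j\<in>B. sgn_of E j)) = (if A = B then 2 ^ CARD('a) else 0)"
proof -
  define f :: "real \<Rightarrow> 'a \<Rightarrow> real" where "f s j = (if j \<in> A then s else 1) * (if j \<in> B then s else 1)" for s j
  have eq: "(\<Prod>j\<in>C. sgn_of E j) = (\<Prod>j\<in>UNIV. if j \<in> C then sgn_of E j else 1)" for C E :: "'a set"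
    by (simp add: prod.If_cases)
  have "(\<Sum>E\<in>UNIV. (\<Prod>j\<in>A. sgn_of E j) * (\<Prod>j\<in>B. sgn_of E j)) = (\<Prod>j\<in>UNIV. f (- 1) j + f 1 j)"
    unfolding prod_add_signs by (simp only: eq[where C = A] eq[where C = B] f_def prod.distrib)
  also have "\<dots> = (if A = B then 2 ^ CARD('a) else 0)"
  proof (cases "A = B")
    case True
    then have "f (- 1) j + f 1 j = 2" for j by (simp add: f_def)
    with True show ?thesis by simp
  next
    case False
    then obtain j where "(j \<in> A) \<noteq> (j \<in> B)" by blast
    then have "f (- 1) j + f 1 j = 0" by (auto simp: f_def)
    then have "(\<Prod>j\<in>UNIV. f (- 1) j + f 1 j) = 0" by (intro prod_zero) auto
    with False show ?thesis by simp
  qed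
  finally show ?thesis .
qed

lemma parseval_signs:
  fixes a :: "'a::finite set \<Rightarrow> real"
  shows "(\<Sum>E\<in>UNIV. (\<Sum>J\<in>UNIV. (\<Prod>j\<in>J. sgn_of E j) * a J)\<^sup>2) = 2 ^ CARD('a) * (\<Sum>J\<in>UNIV. (a J)\<^sup>2)"
proof -
  have "(\<Sum>E\<in>UNIV. (\<Sum>J\<in>UNIV. (\<Prod>j\<in>J. sgn_of E j) * a J)\<^sup>2)
     = (\<Sum>E\<in>UNIV. \<Sum>J\<in>UNIV. \<Sum>K\<in>UNIV. a J * a K * ((\<Prod>j\<in>J. sgn_of E j) * (\<Prod>j\<in>K. sgn_of E j)))"
    by (simp add: power2_eq_square sum_product mult_ac)
  also have "\<dots> = (\<Sum>J\<in>UNIV. \<Sum>K\<in>UNIV. a J * a K * (\<Sum>E\<in>UNIV. (\<Prod>j\<in>J. sgn_of E j) * (\<Prod>j\<in>K. sgn_of E j)))"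
    by (subst sum.swap, rule sum.cong[OF refl], subst sum.swap) (simp add: sum_distrib_left)
  also have "\<dots> = (\<Sum>J\<in>UNIV. a J * a J * 2 ^ CARD('a))"
    unfolding sum_signs_prod by (intro sum.cong refl) (simp add: if_distrib[of "\<lambda>z. _ * z"] cong: if_cong)
  finally show ?thesis by (simp add: power2_eq_square sum_distrib_left mult_ac)
qed

subsection \<open>The Dirichlet integral\<close>

definition bary :: "real ^ 'n::finite \<Rightarrow> 'n option \<Rightarrow> real" where
  "bary x j = (case j of None \<Rightarrow> 1 - (\<Sum>i\<in>UNIV. x $ i) | Some i \<Rightarrow> x $ i)"

lemma bary_simps [simp]: "bary x None = 1 - (\<Sum>i\<in>UNIV. x $ i)" "bary x (Some i) = x $ i"
  by (simp_all add: bary_def)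

lemma sum_option: "(\<Sum>j\<in>UNIV. g j) = g None + (\<Sum>i\<in>UNIV. g (Some (i::'n::finite)))" for g :: "_ \<Rightarrow> 'b::comm_monoid_add"
  by (simp add: UNIV_option_conv sum.reindex)

lemma prod_option: "(\<Prod>j\<in>UNIV. g j) = g None * (\<Prod>i\<in>UNIV. g (Some (i::'n::finite)))" for g :: "_ \<Rightarrow> 'b::comm_monoid_mult"
  by (simp add: UNIV_option_conv prod.reindex)

lemma sum_bary: "(\<Sum>j\<in>UNIV. bary x j) = 1"
  by (simp add: sum_option)

lemma std_simplex_bary: "x \<in> std_simplex \<longleftrightarrow> (\<forall>j. 0 \<le> bary x j)"
  by (auto simp: std_simplex_def split: option.split simp: bary_def)

lemma measurable_vec_nth [measurable]: "(\<lambda>x::real ^ 'n::finite. x $ i) \<in> borel_measurable borel"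
  by (intro borel_measurable_continuous_onI continuous_intros)

lemma continuous_on_bary [continuous_intros]: "continuous_on A (\<lambda>x::real ^ 'n::finite. bary x j)"
  by (cases j) (auto intro!: continuous_intros)

lemma measurable_bary [measurable]: "(\<lambda>x::real ^ 'n::finite. bary x j) \<in> borel_measurable borel"
  by (intro borel_measurable_continuous_onI continuous_intros)

lemma closed_std_simplex: "closed (std_simplex :: (real ^ 'n::finite) set)"
proof -
  have eq: "(std_simplex :: (real ^ 'n) set) = {x. \<forall>j. 0 \<le> bary x j}"
    by (auto simp: std_simplex_bary)
  show ?thesis unfolding eq by (intro closed_Collect_all closed_Collect_le continuous_intros)
qed

lemma std_simplex_borel [measurable]: "std_simplex \<in> sets (borel :: (real ^ 'n::finite) measure)"
  using closed_std_simplex by (rule borel_closed)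

lemma nn_integral_lborel_vec_prod:
  fixes f :: "'n::finite \<Rightarrow> real \<Rightarrow> ennreal"
  assumes "\<And>i. f i \<in> borel_measurable borel"
  shows "(\<integral>\<^sup>+x. (\<Prod>i\<in>UNIV. f i (x $ i)) \<partial>(lborel :: (real ^ 'n) measure)) = (\<Prod>i\<in>UNIV. \<integral>\<^sup>+t. f i t \<partial>lborel)"
proof -
  have bij: "bij_betw (\<lambda>i::'n. axis i (1::real)) UNIV Basis"
    by (auto simp: bij_betw_def Basis_vec_def inj_on_def axis_eq_axis)
  define g where "g b = f (the_inv_into UNIV (\<lambda>i::'n. axis i (1::real)) b)" for b
  have g: "g (axis i 1) = f i" for i
    unfolding g_def using bij by (subst the_inv_into_f_f) (auto simp: bij_betw_def)
  have P: "(\<Prod>b\<in>Basis. h b) = (\<Prod>i\<in>UNIV. h (axis i 1))" for h :: "real ^ 'n \<Rightarrow> ennreal"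
    using prod.reindex_bij_betw[OF bij, of h] by simp
  have "(\<integral>\<^sup>+x. (\<Prod>b\<in>Basis. g b (x \<bullet> b)) \<partial>lborel) = (\<Prod>b\<in>Basis. \<integral>\<^sup>+t. g b t \<partial>lborel)"
    by (rule nn_integral_lborel_prod) (auto simp: g_def assms)
  then show ?thesis by (simp add: P g inner_axis)
qed

lemma nn_integral_lborel_scale:
  fixes f :: "'a::euclidean_space \<Rightarrow> ennreal"
  assumes [measurable]: "f \<in> borel_measurable borel" and "c > 0"
  shows "(\<integral>\<^sup>+x. f x \<partial>lborel) = ennreal (c ^ DIM('a)) * (\<integral>\<^sup>+x. f (c *\<^sub>R x) \<partial>lborel)"
  using assms(2)
  by (subst lborel_affine[of c 0]) (simp_all add: nn_integral_density nn_integral_distr nn_integral_cmult)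

text \<open>Integrate a product of n + 1 unnormalized gamma densities, take the total s of all
  variables as a coordinate and scale the others by s. The integrand splits into a gamma density in
  s and the Dirichlet integrand.\<close>

lemma dirichlet_integral:
  fixes b :: "'n::finite option \<Rightarrow> real"
  assumes b: "\<And>j. b j > 0"
  shows "(\<integral>\<^sup>+x. ennreal (indicator std_simplex x * (\<Prod>j\<in>UNIV. bary x j powr (b j - 1))) \<partial>(lborel :: (real ^ 'n) measure))
    = ennreal ((\<Prod>j\<in>UNIV. Gamma (b j)) / Gamma (\<Sum>j\<in>UNIV. b j))" (is "?I = _")
proof -
  let ?N = "CARD('n)"
  define \<phi> :: "real \<Rightarrow> real \<Rightarrow> real" where "\<phi> \<beta> t = indicator {0..} t * t powr (\<beta> - 1) / exp t" for \<beta> t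
  have [measurable]: "\<phi> \<beta> \<in> borel_measurable borel" for \<beta>
    unfolding \<phi>_def by measurable
  have \<phi>_nn: "\<phi> \<beta> t \<ge> 0" for \<beta> t by (simp add: \<phi>_def)
  have \<phi>_int: "(\<integral>\<^sup>+t. ennreal (\<phi> \<beta> t) \<partial>lborel) = ennreal (Gamma \<beta>)" if "\<beta> > 0" for \<beta>
    unfolding \<phi>_def using Gamma_conv_nn_integral_real[OF that] by simp
  \<comment> \<open>Unnormalized joint density of the first n gamma variables and the total s of all
    n + 1.\<close>
  define H :: "real \<Rightarrow> real ^ 'n \<Rightarrow> real"
    where "H s y = (\<Prod>i\<in>UNIV. \<phi> (b (Some i)) (y $ i)) * \<phi> (b None) (s - (\<Sum>i\<in>UNIV. y $ i))" for s y
  define B where "B = (\<Sum>j\<in>UNIV. b j)"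
  have B_pos: "B > 0" unfolding B_def using b by (intro sum_pos) auto
  have [measurable]: "(\<lambda>(s, y). H s y) \<in> borel_measurable (borel \<Otimes>\<^sub>M borel)"
    unfolding H_def by measurable
  have H_scaled: "H s (s *\<^sub>R x) = (s powr (B - real ?N - 1) / exp s) * (indicator std_simplex x * (\<Prod>j\<in>UNIV. bary x j powr (b j - 1)))"
    if s: "s > 0" for s x
  proof -
    have j: "\<phi> \<beta> (s * t) = (s powr (\<beta> - 1)) * (indicator {0..} t * t powr (\<beta> - 1)) / exp (s * t)" for \<beta> t
      using s by (auto simp: \<phi>_def indicator_def powr_mult zero_le_mult_iff)
    have "H s (s *\<^sub>R x) = (\<Prod>j\<in>UNIV. \<phi> (b j) (s * bary x j))"
      unfolding H_def prod_option by (simp add: algebra_simps sum_distrib_left)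
    also have "\<dots> = (\<Prod>j\<in>UNIV. s powr (b j - 1)) * ((\<Prod>j\<in>UNIV. indicator {0..} (bary x j)) * (\<Prod>j\<in>UNIV. bary x j powr (b j - 1))) / (\<Prod>j\<in>UNIV. exp (s * bary x j))"
      unfolding j by (simp add: prod.distrib prod_dividef)
    also have "(\<Prod>j\<in>UNIV. exp (s * bary x j)) = exp s"
      by (simp only: exp_sum[symmetric] finite sum_distrib_left[symmetric] sum_bary) simp
    also have "(\<Prod>j\<in>UNIV. s powr (b j - 1)) = s powr (B - real ?N - 1)"
      using s by (simp add: powr_sum[symmetric] B_def sum_subtractf diff_diff_eq add.commute)
    also have "(\<Prod>j\<in>UNIV. indicator {0..} (bary x j)) = (indicator std_simplex x :: real)"
      by (auto simp: indicator_def std_simplex_bary intro: prod_zero)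
    finally show ?thesis by simp
  qed
  \<comment> \<open>A nonzero factor forces a strictly positive argument, as
    \<open>0 powr _ = 0\<close>.\<close>
  have H_neg: "H s y = 0" if "s \<le> 0" for s y
  proof (rule ccontr)
    assume "H s y \<noteq> 0"
    then have "y $ i > 0" "s - (\<Sum>i\<in>UNIV. y $ i) > 0" for i
      by (auto simp: H_def \<phi>_def indicator_def less_le split: if_splits)
    then have "(\<Sum>i\<in>UNIV. y $ i) \<ge> 0" by (intro sum_nonneg) (simp add: less_imp_le)
    with \<open>s - (\<Sum>i\<in>UNIV. y $ i) > 0\<close> that show False by simp
  qed
  have "ennreal (\<Prod>j\<in>UNIV. Gamma (b j)) = (\<Prod>i\<in>UNIV. \<integral>\<^sup>+t. ennreal (\<phi> (b (Some i)) t) \<partial>lborel) * (\<integral>\<^sup>+t. ennreal (\<phi> (b None) t) \<partial>lborel)"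
    using b by (simp add: \<phi>_int prod_option prod_ennreal Gamma_real_pos ennreal_mult less_imp_le prod_nonneg mult.commute)
  also have "\<dots> = (\<integral>\<^sup>+y. (\<Prod>i\<in>UNIV. ennreal (\<phi> (b (Some i)) (y $ i))) * (\<integral>\<^sup>+t. ennreal (\<phi> (b None) t) \<partial>lborel) \<partial>(lborel :: (real ^ 'n) measure))"
    by (subst nn_integral_lborel_vec_prod[symmetric]) (simp_all add: nn_integral_multc)
  also have "\<dots> = (\<integral>\<^sup>+y. \<integral>\<^sup>+s. ennreal (H s y) \<partial>lborel \<partial>lborel)"
  proof (intro nn_integral_cong)
    fix y :: "real ^ 'n"
    have "(\<integral>\<^sup>+t. ennreal (\<phi> (b None) t) \<partial>lborel) = (\<integral>\<^sup>+s. ennreal (\<phi> (b None) (s - (\<Sum>i\<in>UNIV. y $ i))) \<partial>lborel)"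
      by (subst nn_integral_real_affine[of _ 1 "- (\<Sum>i\<in>UNIV. y $ i)"]) auto
    then show "(\<Prod>i\<in>UNIV. ennreal (\<phi> (b (Some i)) (y $ i))) * (\<integral>\<^sup>+t. ennreal (\<phi> (b None) t) \<partial>lborel) = (\<integral>\<^sup>+s. ennreal (H s y) \<partial>lborel)"
      by (simp add: H_def ennreal_mult prod_nonneg \<phi>_nn prod_ennreal nn_integral_cmult)
  qed
  also have "\<dots> = (\<integral>\<^sup>+s. \<integral>\<^sup>+y. ennreal (H s y) \<partial>lborel \<partial>lborel)"
    by (rule lborel_pair.Fubini') (simp add: lborel_prod[symmetric])
  also have "\<dots> = (\<integral>\<^sup>+s. ennreal (\<phi> B s) * ?I \<partial>lborel)"
  proof (intro nn_integral_cong)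
    fix s :: real
    show "(\<integral>\<^sup>+y. ennreal (H s y) \<partial>lborel) = ennreal (\<phi> B s) * ?I"
    proof (cases "s > 0")
      case True
      have "(\<integral>\<^sup>+y. ennreal (H s y) \<partial>lborel) = ennreal (s ^ ?N) * (\<integral>\<^sup>+x. ennreal (H s (s *\<^sub>R x)) \<partial>(lborel :: (real ^ 'n) measure))"
        by (subst nn_integral_lborel_scale[OF _ True]) simp_all
      also have "\<dots> = ennreal (s ^ ?N) * (ennreal (s powr (B - real ?N - 1) / exp s) * ?I)"
        unfolding H_scaled[OF True]
        by (subst nn_integral_cmult[symmetric]) (simp_all add: ennreal_mult'[symmetric] del: times_divide_eq_left)
      also have "\<dots> = ennreal (s ^ ?N * (s powr (B - real ?N - 1) / exp s)) * ?I"
        using True by (subst ennreal_mult) (simp_all add: mult.assoc)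
      \<comment> \<open>The Jacobian of the scaling completes the exponent to
        \<open>B - 1\<close>.\<close>
      also have "s ^ ?N * (s powr (B - real ?N - 1) / exp s) = \<phi> B s"
        using True by (simp add: \<phi>_def powr_realpow[symmetric] powr_add[symmetric])
      finally show ?thesis .
    next
      case False
      then have "\<phi> B s = 0" by (cases "s = 0") (auto simp: \<phi>_def)
      with False show ?thesis by (simp add: H_neg)
    qed
  qed
  also have "\<dots> = ennreal (Gamma B) * ?I"
    by (simp add: nn_integral_multc \<phi>_int[OF B_pos])
  finally have eq: "ennreal (\<Prod>j\<in>UNIV. Gamma (b j)) = ennreal (Gamma B) * ?I" .
  have G: "Gamma B > 0" using B_pos by (rule Gamma_real_pos)
  have "?I = ennreal (1 / Gamma B) * (ennreal (Gamma B) * ?I)"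
    using G by (simp add: mult.assoc[symmetric] ennreal_mult[symmetric])
  also have "\<dots> = ennreal ((\<Prod>j\<in>UNIV. Gamma (b j)) / Gamma B)"
    unfolding eq[symmetric] using G b
    by (subst ennreal_mult[symmetric]) (auto intro!: prod_nonneg simp: Gamma_real_pos less_imp_le)
  finally show ?thesis by (simp add: B_def)
qed

subsection \<open>Evaluation and degree of polynomials\<close>

abbreviation mdeg :: "('n::finite \<Rightarrow>\<^sub>0 nat) \<Rightarrow> nat" where
  "mdeg \<alpha> \<equiv> \<Sum>i\<in>UNIV. Poly_Mapping.lookup \<alpha> i"

definition monom_eval :: "('n::finite \<Rightarrow>\<^sub>0 nat) \<Rightarrow> real ^ 'n \<Rightarrow> real" where
  "monom_eval \<alpha> x = (\<Prod>i\<in>UNIV. (x $ i) ^ Poly_Mapping.lookup \<alpha> i)"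

lemma monom_eval_0 [simp]: "monom_eval 0 x = 1"
  by (simp add: monom_eval_def)

lemma monom_eval_add: "monom_eval (\<alpha> + \<beta>) x = monom_eval \<alpha> x * monom_eval \<beta> x"
  by (simp add: monom_eval_def lookup_add power_add prod.distrib)

lemma poly_eval_superset:
  assumes "finite A" "Poly_Mapping.keys p \<subseteq> A"
  shows "poly_eval p x = (\<Sum>\<alpha>\<in>A. Poly_Mapping.lookup p \<alpha> * monom_eval \<alpha> x)"
  unfolding poly_eval_def monom_eval_def[symmetric] using assms
  by (intro sum.mono_neutral_left) (auto simp: in_keys_iff)

lemma poly_eval_single [simp]: "poly_eval (Poly_Mapping.single \<alpha> c) x = c * monom_eval \<alpha> x"
  by (subst poly_eval_superset[of "{\<alpha>}"]) (auto split: if_splits)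

lemma poly_eval_0 [simp]: "poly_eval 0 x = 0"
  by (simp add: poly_eval_def)

lemma poly_eval_1 [simp]: "poly_eval 1 x = 1"
  using poly_eval_single[of 0 1 x] by simp

lemma poly_eval_add [simp]: "poly_eval (p + q) x = poly_eval p x + poly_eval q x"
proof -
  let ?A = "Poly_Mapping.keys p \<union> Poly_Mapping.keys q"
  have "Poly_Mapping.keys (p + q) \<subseteq> ?A" by (rule keys_add)
  then show ?thesis
    by (simp add: poly_eval_superset[of ?A] lookup_add distrib_right sum.distrib)
qed

lemma poly_eval_minus [simp]: "poly_eval (- p) x = - poly_eval p x"
  using poly_eval_add[of p "- p" x] by simp

lemma poly_eval_diff [simp]: "poly_eval (p - q) x = poly_eval p x - poly_eval q x"
  using poly_eval_add[of p "- q" x] by simp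

lemma poly_eval_sum [simp]: "poly_eval (\<Sum>a\<in>A. p a) x = (\<Sum>a\<in>A. poly_eval (p a) x)"
  by (induction A rule: infinite_finite_induct) auto

lemma poly_mapping_sum_single:
  "p = (\<Sum>\<alpha>\<in>Poly_Mapping.keys p. Poly_Mapping.single \<alpha> (Poly_Mapping.lookup p \<alpha>))"
  by (rule poly_mapping_eqI) (auto simp: lookup_sum lookup_single when_def in_keys_iff)

lemma poly_eval_mult [simp]: "poly_eval (p * q) x = poly_eval p x * poly_eval q x"
proof -
  have "poly_eval ((\<Sum>\<alpha>\<in>A. Poly_Mapping.single \<alpha> (a \<alpha>)) * (\<Sum>\<beta>\<in>B. Poly_Mapping.single \<beta> (b \<beta>))) x
    = poly_eval (\<Sum>\<alpha>\<in>A. Poly_Mapping.single \<alpha> (a \<alpha>)) x * poly_eval (\<Sum>\<beta>\<in>B. Poly_Mapping.single \<beta> (b \<beta>)) x"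
    for A B a b
    by (simp add: sum_product mult_single monom_eval_add mult_ac)
  from this[where A = "Poly_Mapping.keys p" and a = "Poly_Mapping.lookup p"
      and B = "Poly_Mapping.keys q" and b = "Poly_Mapping.lookup q"]
  show ?thesis by (simp only: poly_mapping_sum_single[symmetric])
qed

lemma poly_eval_power [simp]: "poly_eval (p ^ k) x = poly_eval p x ^ k"
  by (induction k) auto

lemma poly_eval_prod [simp]: "poly_eval (\<Prod>a\<in>A. p a) x = (\<Prod>a\<in>A. poly_eval (p a) x)"
  by (induction A rule: infinite_finite_induct) auto

lemma poly_eval_constraint: "poly_eval (simplex_constraint j) x = bary x j"
proof -
  have "poly_eval (var i) x = x $ i" for i
  proof -
    have "(\<Prod>k\<in>UNIV. (x $ k) ^ Poly_Mapping.lookup (Poly_Mapping.single i 1) k) = (\<Prod>k\<in>UNIV. if k = i then x $ k else 1)"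
      by (intro prod.cong) (auto simp: lookup_single when_def)
    then show ?thesis by (simp add: var_def monom_eval_def)
  qed
  then show ?thesis by (cases j) (simp_all add: simplex_constraint_def)
qed

lemma total_degree_le_iff: "total_degree p \<le> m \<longleftrightarrow> (\<forall>\<alpha>\<in>Poly_Mapping.keys p. mdeg \<alpha> \<le> m)"
  by (auto simp: total_degree_def)

lemma mdeg_le_total_degree: "\<alpha> \<in> Poly_Mapping.keys p \<Longrightarrow> mdeg \<alpha> \<le> total_degree p"
  using total_degree_le_iff by blast

lemma total_degree_0 [simp]: "total_degree 0 = 0"
  using total_degree_le_iff[of 0 0] by simp

lemma total_degree_1 [simp]: "total_degree (1 :: 'n::finite rpoly) = 0"
proof -
  have "total_degree (1 :: 'n rpoly) \<le> 0" unfolding total_degree_le_iff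
    using keys_single[of 0 "1::real"] by (auto split: if_splits)
  then show ?thesis by simp
qed

lemma total_degree_minus [simp]: "total_degree (- p) = total_degree p"
  by (simp add: total_degree_def keys_minus)

lemma total_degree_sum:
  assumes "\<And>a. a \<in> A \<Longrightarrow> total_degree (p a) \<le> m"
  shows "total_degree (\<Sum>a\<in>A. p a) \<le> m"
  using assms keys_sum[of p A] unfolding total_degree_le_iff by blast

lemma total_degree_mult:
  "total_degree (p * q) \<le> total_degree p + total_degree q"
  unfolding total_degree_le_iff
proof
  fix \<gamma> assume "\<gamma> \<in> Poly_Mapping.keys (p * q)"
  then obtain \<alpha> \<beta> where *: "\<alpha> \<in> Poly_Mapping.keys p" "\<beta> \<in> Poly_Mapping.keys q" "\<gamma> = \<alpha> + \<beta>"
    using keys_mult[of p q] by blast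
  then show "mdeg \<gamma> \<le> total_degree p + total_degree q"
    using mdeg_le_total_degree[OF *(1)] mdeg_le_total_degree[OF *(2)] by (simp add: lookup_add sum.distrib)
qed

lemma total_degree_prod:
  "finite A \<Longrightarrow> total_degree (\<Prod>a\<in>A. p a) \<le> (\<Sum>a\<in>A. total_degree (p a))"
  by (induction A rule: finite_induct) (auto intro: order_trans[OF total_degree_mult])

lemma total_degree_constraint: "total_degree (simplex_constraint (j :: 'n::finite option)) \<le> 1"
proof -
  have v: "total_degree (var i) \<le> 1" for i :: 'n
    unfolding total_degree_le_iff var_def by (auto simp: lookup_single when_def)
  have "total_degree (1 - (\<Sum>i\<in>UNIV. var i) :: 'n rpoly) \<le> 1"
  proof -
    have "Poly_Mapping.keys (1 - (\<Sum>i\<in>UNIV. var i) :: 'n rpoly) \<subseteq> Poly_Mapping.keys (1 :: 'n rpoly) \<union> Poly_Mapping.keys (\<Sum>i\<in>UNIV. var i :: 'n rpoly)"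
      by (rule keys_diff)
    moreover have "total_degree (\<Sum>i\<in>UNIV. var i :: 'n rpoly) \<le> 1" by (intro total_degree_sum v)
    moreover have "total_degree (1 :: 'n rpoly) \<le> 1" by simp
    ultimately show ?thesis unfolding total_degree_le_iff by blast
  qed
  with v show ?thesis by (cases j) (auto simp: simplex_constraint_def)
qed

subsection \<open>Even powers of a linear form as elements of the preordering\<close>

text \<open>\<open>lin_coeff u m J\<close> is the polynomial in the squares \<open>v\<^sub>j\<^sup>2\<close> that multiplies \<open>\<Prod>j\<in>J. v\<^sub>j\<close> in
  \<open>(\<Sum>\<^sub>j u\<^sub>j v\<^sub>j)\<^sup>m\<close>.\<close>

fun lin_coeff :: "('n::finite option \<Rightarrow> real) \<Rightarrow> nat \<Rightarrow> 'n option set \<Rightarrow> 'n rpoly" where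
  "lin_coeff u 0 J = (if J = {} then 1 else 0)"
| "lin_coeff u (Suc m) J = (\<Sum>j\<in>UNIV. Poly_Mapping.single 0 (u j) *
     (if j \<in> J then lin_coeff u m (J - {j}) else simplex_constraint j * lin_coeff u m (insert j J)))"

lemma lin_coeff_eval:
  fixes v :: "'n::finite option \<Rightarrow> real"
  assumes "\<And>j. (v j)\<^sup>2 = bary x j"
  shows "(\<Sum>j\<in>UNIV. u j * v j) ^ m = (\<Sum>J\<in>UNIV. (\<Prod>j\<in>J. v j) * poly_eval (lin_coeff u m J) x)"
proof (induction m)
  case 0
  have "(\<Sum>J\<in>UNIV. (\<Prod>j\<in>J. v j) * poly_eval (lin_coeff u 0 J) x) = (\<Sum>J\<in>(UNIV :: 'n option set set). if J = {} then 1 else 0)"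
    by (intro sum.cong) auto
  then show ?case by simp
next
  case (Suc m)
  let ?e = "\<lambda>J. poly_eval (lin_coeff u m J) x" and ?t = "\<lambda>j J. if j \<in> J then J - {j} else insert j J"
  have "(\<Sum>j\<in>UNIV. u j * v j) ^ Suc m = (\<Sum>j\<in>UNIV. \<Sum>J\<in>UNIV. u j * v j * ((\<Prod>j\<in>J. v j) * ?e J))"
    unfolding power_Suc Suc sum_product ..
  \<comment> \<open>Multiplication by \<open>v j\<close> toggles the membership of j in J;
    reindexing by this involution produces the recursion of \<open>lin_coeff\<close>.\<close>
  also have "\<dots> = (\<Sum>j\<in>UNIV. \<Sum>J\<in>UNIV. u j * v j * ((\<Prod>j\<in>?t j J. v j) * ?e (?t j J)))"
  proof (rule sum.cong[OF refl])
    fix j :: "'n option"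
    have "bij (?t j)" by (rule involuntory_imp_bij) auto
    from sum.reindex_bij_betw[OF this, of "\<lambda>J. u j * v j * ((\<Prod>j\<in>J. v j) * ?e J)"]
    show "(\<Sum>J\<in>UNIV. u j * v j * ((\<Prod>j\<in>J. v j) * ?e J)) = (\<Sum>J\<in>UNIV. u j * v j * ((\<Prod>j\<in>?t j J. v j) * ?e (?t j J)))"
      by simp
  qed
  also have "\<dots> = (\<Sum>j\<in>UNIV. \<Sum>J\<in>UNIV. (\<Prod>j\<in>J. v j) * (u j * (if j \<in> J then ?e (J - {j}) else bary x j * ?e (insert j J))))"
  proof (intro sum.cong refl)
    fix j J
    show "u j * v j * ((\<Prod>j\<in>?t j J. v j) * ?e (?t j J)) = (\<Prod>j\<in>J. v j) * (u j * (if j \<in> J then ?e (J - {j}) else bary x j * ?e (insert j J)))"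
    proof (cases "j \<in> J")
      case True
      then have "(\<Prod>j\<in>J. v j) = v j * (\<Prod>j\<in>J - {j}. v j)" by (simp add: prod.remove)
      with True show ?thesis by simp
    next
      case False
      then have "(\<Prod>j\<in>insert j J. v j) = v j * (\<Prod>j\<in>J. v j)" by simp
      with False show ?thesis by (simp add: assms[symmetric] power2_eq_square)
    qed
  qed
  also have "\<dots> = (\<Sum>J\<in>UNIV. (\<Prod>j\<in>J. v j) * poly_eval (lin_coeff u (Suc m) J) x)"
    by (subst sum.swap) (simp add: poly_eval_constraint sum_distrib_left if_distrib[of "\<lambda>p. poly_eval p x"] cong: if_cong)
  finally show ?case .
qed

text \<open>Grading by degree in v: a constraint stands for a square and counts twice, an element of
  J counts once. The trade-off with \<open>card J\<close> is what the degree condition of the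
  preordering needs.\<close>

lemma lin_coeff_keys:
  "\<alpha> \<in> Poly_Mapping.keys (lin_coeff u m J) \<Longrightarrow> 2 * mdeg \<alpha> + card J \<le> m"
proof (induction m arbitrary: \<alpha> J)
  case 0
  then show ?case using keys_single[of 0 "1::real"] by (auto split: if_splits)
next
  case (Suc m)
  define q where "q j = (if j \<in> J then lin_coeff u m (J - {j}) else simplex_constraint j * lin_coeff u m (insert j J))" for j
  from Suc.prems obtain j where "\<alpha> \<in> Poly_Mapping.keys (Poly_Mapping.single 0 (u j) * q j)"
    using keys_sum[of "\<lambda>j. Poly_Mapping.single 0 (u j) * q j" UNIV] by (auto simp: q_def)
  then obtain \<alpha>0 \<beta> where "\<alpha>0 \<in> Poly_Mapping.keys (Poly_Mapping.single (0 :: 'a \<Rightarrow>\<^sub>0 nat) (u j))" "\<beta> \<in> Poly_Mapping.keys (q j)" "\<alpha> = \<alpha>0 + \<beta>"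
    using keys_mult[of "Poly_Mapping.single 0 (u j)" "q j"] by blast
  then have \<alpha>: "\<alpha> \<in> Poly_Mapping.keys (q j)" by (auto split: if_splits)
  show ?case
  proof (cases "j \<in> J")
    case True
    with \<alpha> have "2 * mdeg \<alpha> + card (J - {j}) \<le> m" by (intro Suc.IH) (simp add: q_def)
    moreover have "card J = Suc (card (J - {j}))" using True by (simp only: card.remove[of J j] finite)
    ultimately show ?thesis by simp
  next
    case False
    with \<alpha> obtain \<beta> \<gamma> where *: "\<beta> \<in> Poly_Mapping.keys (simplex_constraint j)" "\<gamma> \<in> Poly_Mapping.keys (lin_coeff u m (insert j J))" "\<alpha> = \<beta> + \<gamma>"
      using keys_mult[of "simplex_constraint j" "lin_coeff u m (insert j J)"] by (auto simp: q_def)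
    have "mdeg \<beta> \<le> 1" using *(1) total_degree_constraint[of j] unfolding total_degree_le_iff by blast
    moreover have "2 * mdeg \<gamma> + card (insert j J) \<le> m" using *(2) by (rule Suc.IH)
    ultimately show ?thesis using False *(3) by (simp add: lookup_add sum.distrib)
  qed
qed

text \<open>The factor of \<open>\<Prod>j\<in>J. v j\<close> in P(<u, v>^2), with the squares of the
  v j replaced by constraints.\<close>

definition kernel_coeff :: "real poly \<Rightarrow> ('n::finite option \<Rightarrow> real) \<Rightarrow> 'n option set \<Rightarrow> 'n rpoly" where
  "kernel_coeff P u J = (\<Sum>m\<le>degree P. Poly_Mapping.single 0 (coeff P m) * lin_coeff u (2 * m) J)"

text \<open>The sign average of P(<u, v>^2)^2, written through its diagonal terms so that each
  summand is visibly a square times a product of constraints.\<close>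

definition zonal_kernel :: "real poly \<Rightarrow> ('n::finite option \<Rightarrow> real) \<Rightarrow> 'n rpoly" where
  "zonal_kernel P u = (\<Sum>J\<in>UNIV. (kernel_coeff P u J)\<^sup>2 * (\<Prod>j\<in>J. simplex_constraint j))"

lemma kernel_coeff_keys:
  assumes "\<alpha> \<in> Poly_Mapping.keys (kernel_coeff P u J)"
  shows "2 * mdeg \<alpha> + card J \<le> 2 * degree P"
proof -
  from assms obtain m where m: "m \<le> degree P" "\<alpha> \<in> Poly_Mapping.keys (Poly_Mapping.single 0 (coeff P m) * lin_coeff u (2 * m) J)"
    unfolding kernel_coeff_def using keys_sum[of "\<lambda>m. Poly_Mapping.single 0 (coeff P m) * lin_coeff u (2 * m) J" "{..degree P}"] by auto
  have "\<alpha> \<in> Poly_Mapping.keys (lin_coeff u (2 * m) J)"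
    using m(2) keys_mult[of "Poly_Mapping.single 0 (coeff P m)" "lin_coeff u (2 * m) J"] by (auto split: if_splits)
  from lin_coeff_keys[OF this] m(1) show ?thesis by simp
qed

lemma kernel_in_preordering:
  assumes "degree P \<le> r"
  shows "zonal_kernel P u \<in> simplex_preordering (2 * r)"
proof -
  have sos: "p\<^sup>2 \<in> sos_polys" for p :: "'a rpoly"
    unfolding sos_polys_def by (intro CollectI exI[of _ 1] exI[of _ "\<lambda>_. p"]) simp
  have deg: "total_degree ((kernel_coeff P u J)\<^sup>2 * (\<Prod>j\<in>J. simplex_constraint j)) \<le> 2 * r" for J
  \<comment> \<open>A zero coefficient has no monomial from which \<open>card J\<close> could be
    bounded.\<close>
  proof (cases "kernel_coeff P u J = 0")
    case False
    let ?c = "kernel_coeff P u J"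
    have le: "2 * mdeg \<alpha> + card J \<le> 2 * r" if "\<alpha> \<in> Poly_Mapping.keys ?c" for \<alpha>
      using kernel_coeff_keys[OF that] assms by simp
    from False obtain \<alpha> where "\<alpha> \<in> Poly_Mapping.keys ?c" by fastforce
    then have J: "card J \<le> 2 * r" using le by fastforce
    have "total_degree ?c \<le> (2 * r - card J) div 2"
      unfolding total_degree_le_iff using le by fastforce
    moreover have "total_degree (?c\<^sup>2) \<le> total_degree ?c + total_degree ?c"
      unfolding power2_eq_square by (rule total_degree_mult)
    moreover have "total_degree (\<Prod>j\<in>J. simplex_constraint j) \<le> card J"
      using total_degree_prod[of J simplex_constraint] sum_bounded_above[of J "\<lambda>j. total_degree (simplex_constraint j)" 1]
        total_degree_constraint by fastforce
    moreover note total_degree_mult[of "?c\<^sup>2" "\<Prod>j\<in>J. simplex_constraint j"]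
    ultimately show ?thesis using J by linarith
  qed simp
  show ?thesis
    unfolding simplex_preordering_def zonal_kernel_def
    by (intro CollectI exI[of _ "\<lambda>J. (kernel_coeff P u J)\<^sup>2"]) (use sos deg in auto)
qed

definition signed_dot :: "('n::finite option \<Rightarrow> real) \<Rightarrow> real ^ 'n \<Rightarrow> 'n option set \<Rightarrow> real" where
  "signed_dot u x E = (\<Sum>j\<in>UNIV. u j * (sgn_of E j * sqrt (bary x j)))"

lemma sgn_of_sq [simp]: "(sgn_of E j)\<^sup>2 = 1"
  by (simp add: sgn_of_def)

text \<open>E runs over the sets of negative coordinates of a lift of x. As a function of E,
  \<open>poly P ((signed_dot u x E)\<^sup>2)\<close> is a combination of sign characters with
  coefficients \<open>a J\<close>, and Parseval sums their squares.\<close>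

lemma kernel_eval:
  fixes x :: "real ^ 'n::finite"
  assumes x: "x \<in> std_simplex"
  shows "2 ^ CARD('n option) * poly_eval (zonal_kernel P u) x = (\<Sum>E\<in>UNIV. (poly P ((signed_dot u x E)\<^sup>2))\<^sup>2)"
proof -
  have nn: "bary x j \<ge> 0" for j using x by (simp add: std_simplex_bary)
  define a where "a J = (\<Prod>j\<in>J. sqrt (bary x j)) * poly_eval (kernel_coeff P u J) x" for J
  have "poly P ((signed_dot u x E)\<^sup>2) = (\<Sum>J\<in>UNIV. (\<Prod>j\<in>J. sgn_of E j) * a J)" for E
  proof -
    have "poly P ((signed_dot u x E)\<^sup>2) = (\<Sum>m\<le>degree P. coeff P m * signed_dot u x E ^ (2 * m))"
      by (simp add: poly_altdef power_mult)
    also have "\<dots> = (\<Sum>m\<le>degree P. \<Sum>J\<in>UNIV. coeff P m * ((\<Prod>j\<in>J. sgn_of E j * sqrt (bary x j)) * poly_eval (lin_coeff u (2 * m) J) x))"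
      unfolding signed_dot_def
      by (subst lin_coeff_eval[where x = x]) (simp_all add: power_mult_distrib nn sum_distrib_left)
    also have "\<dots> = (\<Sum>J\<in>UNIV. (\<Prod>j\<in>J. sgn_of E j) * a J)"
      by (subst sum.swap) (simp add: a_def kernel_coeff_def sum_distrib_left prod.distrib mult_ac)
    finally show ?thesis .
  qed
  then have "(\<Sum>E\<in>UNIV. (poly P ((signed_dot u x E)\<^sup>2))\<^sup>2) = 2 ^ CARD('n option) * (\<Sum>J\<in>UNIV. (a J)\<^sup>2)"
    using parseval_signs[of a] by simp
  also have "(\<Sum>J\<in>UNIV. (a J)\<^sup>2) = poly_eval (zonal_kernel P u) x"
    by (simp add: zonal_kernel_def a_def power_mult_distrib prod_power_distrib nn poly_eval_constraint mult.commute)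
  finally show ?thesis ..
qed

subsection \<open>The measure on the simplex\<close>

lemma continuous_on_poly_eval [continuous_intros]: "continuous_on A (poly_eval p)"
  unfolding poly_eval_def by (intro continuous_intros)

lemma compact_std_simplex: "compact (std_simplex :: (real ^ 'n::finite) set)"
proof -
  have "norm x \<le> 1" if "x \<in> std_simplex" for x :: "real ^ 'n"
  proof -
    have "norm x \<le> (\<Sum>i\<in>UNIV. \<bar>x $ i\<bar>)" by (rule norm_le_l1_cart)
    also have "\<dots> = (\<Sum>i\<in>UNIV. x $ i)" using that by (intro sum.cong) (auto simp: std_simplex_def)
    finally show ?thesis using that by (simp add: std_simplex_def)
  qed
  then show ?thesis
    using closed_std_simplex by (auto simp: compact_eq_bounded_closed bounded_iff)
qed

lemma zero_in_std_simplex: "0 \<in> std_simplex"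
  by (simp add: std_simplex_def)

lemma simplex_weight_bary: "simplex_weight x = (\<Prod>j\<in>UNIV. bary x j powr (- 1 / 2))"
  by (simp add: simplex_weight_def prod_option mult.commute)

lemma measurable_simplex_weight [measurable]: "simplex_weight \<in> borel_measurable borel"
  unfolding simplex_weight_def by measurable

lemma simplex_weight_nonneg: "simplex_weight x \<ge> 0"
  unfolding simplex_weight_bary by (intro prod_nonneg) simp

lemma simplex_weight_moment:
  fixes \<alpha> :: "'n::finite option \<Rightarrow> nat"
  shows "(\<integral>\<^sup>+x. ennreal (indicator std_simplex x * (simplex_weight x * (\<Prod>j\<in>UNIV. bary x j ^ \<alpha> j))) \<partial>(lborel :: (real ^ 'n) measure))
    = ennreal ((\<Prod>j\<in>UNIV. Gamma (1 / 2 + real (\<alpha> j))) / Gamma ((real CARD('n) + 1) / 2 + real (\<Sum>j\<in>UNIV. \<alpha> j)))"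
proof -
  have eq: "indicator std_simplex x * (simplex_weight x * (\<Prod>j\<in>UNIV. bary x j ^ \<alpha> j))
      = indicator std_simplex x * (\<Prod>j\<in>UNIV. bary x j powr (1 / 2 + real (\<alpha> j) - 1))" for x :: "real ^ 'n"
  proof (cases "x \<in> std_simplex")
    case True
    have "bary x j powr (- 1 / 2) * bary x j ^ \<alpha> j = bary x j powr (1 / 2 + real (\<alpha> j) - 1)" for j
    \<comment> \<open>On the boundary both sides are 0, since \<open>0 powr _ = 0\<close>.\<close>
    proof (cases "bary x j = 0")
      case False
      with True have "bary x j > 0" by (auto simp: std_simplex_bary less_le)
      then show ?thesis by (simp add: powr_realpow[symmetric] powr_add[symmetric])
    qed simp
    then show ?thesis unfolding simplex_weight_bary by (simp add: prod.distrib[symmetric])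
  qed simp
  have "(\<Sum>j\<in>UNIV. 1 / 2 + real (\<alpha> j)) = (real CARD('n) + 1) / 2 + real (\<Sum>j\<in>UNIV. \<alpha> j)"
    by (simp add: sum.distrib add.commute)
  then show ?thesis
    unfolding eq by (subst dirichlet_integral) (simp_all add: add_pos_nonneg)
qed

lemma simplex_const_eq:
  "simplex_const TYPE('n::finite) = Gamma ((real CARD('n) + 1) / 2) / Gamma (1 / 2) ^ CARD('n option)"
proof -
  have "(LINT x:(std_simplex :: (real ^ 'n) set)|lborel. simplex_weight x)
      = enn2real (\<integral>\<^sup>+x. ennreal (indicator std_simplex x * simplex_weight x) \<partial>(lborel :: (real ^ 'n) measure))"
    unfolding set_lebesgue_integral_def
    by (subst integral_eq_nn_integral) (auto simp: simplex_weight_nonneg)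
  also have "\<dots> = Gamma (1 / 2) ^ CARD('n option) / Gamma ((real CARD('n) + 1) / 2)"
    using simplex_weight_moment[of "\<lambda>_ :: 'n option. 0"]
    by (simp add: Gamma_real_pos less_imp_le del: card_option)
  finally show ?thesis by (simp add: simplex_const_def)
qed

lemma simplex_const_pos: "simplex_const TYPE('n::finite) > 0"
  unfolding simplex_const_eq by (intro divide_pos_pos zero_less_power Gamma_real_pos) auto

lemma sets_simplex_measure [measurable_cong, simp]: "sets simplex_measure = sets borel"
  by (simp add: simplex_measure_def)

lemma space_simplex_measure [simp]: "space simplex_measure = UNIV"
  by (simp add: simplex_measure_def)

lemma simplex_measure_moment:
  fixes \<alpha> :: "'n::finite option \<Rightarrow> nat"
  shows "(\<integral>\<^sup>+x. ennreal (\<Prod>j\<in>UNIV. bary x j ^ \<alpha> j) \<partial>(simplex_measure :: (real ^ 'n) measure))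
    = ennreal ((\<Prod>j\<in>UNIV. pochhammer (1 / 2) (\<alpha> j)) / pochhammer ((real CARD('n) + 1) / 2) (\<Sum>j\<in>UNIV. \<alpha> j))"
proof -
  let ?c = "simplex_const TYPE('n)"
  have G: "Gamma (z + real k) = pochhammer z k * Gamma z" if "z > 0" for z :: real and k
    proof -
    have "z \<notin> \<int>\<^sub>\<le>\<^sub>0" using that by (auto elim!: nonpos_Ints_cases)
    then show ?thesis using pochhammer_Gamma[of z k] Gamma_real_pos[OF that] by (simp add: field_simps)
  qed
  have "(\<integral>\<^sup>+x. ennreal (\<Prod>j\<in>UNIV. bary x j ^ \<alpha> j) \<partial>(simplex_measure :: (real ^ 'n) measure))
     = (\<integral>\<^sup>+x. ennreal ?c * ennreal (indicator std_simplex x * (simplex_weight x * (\<Prod>j\<in>UNIV. bary x j ^ \<alpha> j))) \<partial>lborel)"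
    unfolding simplex_measure_def
    by (subst nn_integral_density)
       (auto intro!: nn_integral_cong simp: ennreal_mult'[symmetric] simplex_const_pos less_imp_le simplex_weight_nonneg mult_ac)
  also have "\<dots> = ennreal ?c * ennreal ((\<Prod>j\<in>UNIV. Gamma (1 / 2 + real (\<alpha> j))) / Gamma ((real CARD('n) + 1) / 2 + real (\<Sum>j\<in>UNIV. \<alpha> j)))"
    by (subst nn_integral_cmult) (simp_all add: simplex_weight_moment)
  also have "\<dots> = ennreal (?c * ((\<Prod>j\<in>UNIV. Gamma (1 / 2 + real (\<alpha> j))) / Gamma ((real CARD('n) + 1) / 2 + real (\<Sum>j\<in>UNIV. \<alpha> j))))"
    using simplex_const_pos[where ?'n = 'n] by (intro ennreal_mult'[symmetric]) simp
  also have "?c * ((\<Prod>j\<in>UNIV. Gamma (1 / 2 + real (\<alpha> j))) / Gamma ((real CARD('n) + 1) / 2 + real (\<Sum>j\<in>UNIV. \<alpha> j)))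
     = (\<Prod>j\<in>UNIV. pochhammer (1 / 2) (\<alpha> j)) / pochhammer ((real CARD('n) + 1) / 2) (\<Sum>j\<in>UNIV. \<alpha> j)"
  proof -
    have nz: "Gamma (1 / 2 :: real) \<noteq> 0" "Gamma ((real CARD('n) + 1) / 2) \<noteq> 0"
      by (rule less_imp_neq[THEN not_sym], rule Gamma_real_pos, simp)+
    have 1: "Gamma (1 / 2 + real k) = pochhammer (1 / 2) k * Gamma (1 / 2)" for k by (rule G) simp
    have 2: "Gamma ((real CARD('n) + 1) / 2 + real k) = pochhammer ((real CARD('n) + 1) / 2) k * Gamma ((real CARD('n) + 1) / 2)" for k
      by (rule G) simp
    show ?thesis
      unfolding 1 2 simplex_const_eq prod.distrib using nz by (simp del: card_option of_nat_sum)
  qed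
  finally show ?thesis .
qed

lemma emeasure_simplex: "emeasure (simplex_measure :: (real ^ 'n::finite) measure) UNIV = 1"
proof -
  show ?thesis
    using simplex_measure_moment[of "\<lambda>_ :: 'n option. 0"] by simp
qed

lemma AE_simplex: "AE x in simplex_measure. x \<in> (std_simplex :: (real ^ 'n::finite) set)"
  unfolding simplex_measure_def by (subst AE_density) (auto simp: indicator_def)

lemma AE_simplexI:
  assumes "AE x in lborel. P (x :: real ^ 'n::finite)"
  shows "AE x in simplex_measure. P x"
  unfolding simplex_measure_def using assms by (subst AE_density) auto

lemma integrable_simplex [intro]:
  fixes g :: "real ^ 'n::finite \<Rightarrow> real"
  assumes "continuous_on UNIV g"
  shows "integrable simplex_measure g"
proof -
  interpret finite_measure "simplex_measure :: (real ^ 'n) measure"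
    by (rule finite_measureI) (simp add: emeasure_simplex)
  have "compact (g ` std_simplex)"
    using compact_std_simplex assms by (intro compact_continuous_image) (auto intro: continuous_on_subset)
  then obtain B where "\<And>x. x \<in> std_simplex \<Longrightarrow> norm (g x) \<le> B"
    by (meson bounded_iff compact_imp_bounded imageI)
  then show ?thesis
    using borel_measurable_continuous_onI[OF assms] AE_simplex
    by (intro integrable_const_bound[of _ B]) (auto simp: measurable_cong_sets[OF sets_simplex_measure refl])
qed

lemma integral_simplex_mono:
  fixes g h :: "real ^ 'n::finite \<Rightarrow> real"
  assumes "continuous_on UNIV g" "continuous_on UNIV h" "\<And>x. x \<in> std_simplex \<Longrightarrow> g x \<le> h x"
  shows "(LINT x|simplex_measure. g x) \<le> (LINT x|simplex_measure. h x)"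
  using assms AE_simplex by (intro integral_mono_AE integrable_simplex) auto

lemma integral_simplex_cong:
  fixes g h :: "real ^ 'n::finite \<Rightarrow> real"
  assumes "continuous_on UNIV g" "continuous_on UNIV h" "\<And>x. x \<in> std_simplex \<Longrightarrow> g x = h x"
  shows "(LINT x|simplex_measure. g x) = (LINT x|simplex_measure. h x)"
  using assms by (intro antisym integral_simplex_mono) auto

lemma integral_simplex_const: "(LINT x|(simplex_measure :: (real ^ 'n::finite) measure). c) = (c :: real)"
proof -
  interpret finite_measure "simplex_measure :: (real ^ 'n) measure"
    by (rule finite_measureI) (simp add: emeasure_simplex)
  show ?thesis by (simp add: measure_def emeasure_simplex)
qed

lemma integral_simplex_moment:
  fixes \<alpha> :: "'n::finite option \<Rightarrow> nat"
  shows "(LINT x|(simplex_measure :: (real ^ 'n) measure). (\<Prod>j\<in>UNIV. bary x j ^ \<alpha> j))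
    = (\<Prod>j\<in>UNIV. pochhammer (1 / 2) (\<alpha> j)) / pochhammer ((real CARD('n) + 1) / 2) (\<Sum>j\<in>UNIV. \<alpha> j)"
proof -
  have "AE x in simplex_measure. 0 \<le> (\<Prod>j\<in>UNIV. bary (x :: real ^ 'n) j ^ \<alpha> j)"
    using AE_simplex by eventually_elim (auto simp: std_simplex_bary intro!: prod_nonneg)
  then have "(LINT x|(simplex_measure :: (real ^ 'n) measure). (\<Prod>j\<in>UNIV. bary x j ^ \<alpha> j))
     = enn2real (ennreal ((\<Prod>j\<in>UNIV. pochhammer (1 / 2) (\<alpha> j)) / pochhammer ((real CARD('n) + 1) / 2) (\<Sum>j\<in>UNIV. \<alpha> j)))"
    by (subst integral_eq_nn_integral) (auto simp: simplex_measure_moment)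
  also have "\<dots> = (\<Prod>j\<in>UNIV. pochhammer (1 / 2) (\<alpha> j)) / pochhammer ((real CARD('n) + 1) / 2) (\<Sum>j\<in>UNIV. \<alpha> j)"
    by (intro enn2real_ennreal divide_nonneg_nonneg prod_nonneg) (auto intro!: less_imp_le pochhammer_pos)
  finally show ?thesis .
qed

text \<open>One coordinate has the Beta(1/2, n/2) law: its moments are Dirichlet moments with one
  nonzero exponent. For positivity, a zero integral would put almost every point on finitely many
  hyperplanes given by the roots of p.\<close>

lemma coordinate_functional:
  "jacobi_functional (real CARD('n) / 2) (\<lambda>p. LINT x|(simplex_measure :: (real ^ 'n::finite) measure). poly p (x $ i))"
proof
  have cont: "continuous_on UNIV (\<lambda>x :: real ^ 'n. poly p (x $ i))" for p
    by (intro continuous_intros)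
  show "0 < real CARD('n) / 2" by simp
  show "(LINT x|simplex_measure. poly (p + q) ((x :: real ^ 'n) $ i)) = (LINT x|simplex_measure. poly p (x $ i)) + (LINT x|simplex_measure. poly q (x $ i))" for p q
    using cont by (simp add: integrable_simplex)
  show "(LINT x|simplex_measure. poly (smult c p) ((x :: real ^ 'n) $ i)) = c * (LINT x|simplex_measure. poly p (x $ i))" for c p
    by simp
  show "(LINT x|simplex_measure. poly (monom 1 m) ((x :: real ^ 'n) $ i)) = pochhammer (1 / 2) m / pochhammer (real CARD('n) / 2 + 1 / 2) m" for m
    using integral_simplex_moment[of "\<lambda>j. if j = Some i then m else 0"]
    by (simp add: poly_monom if_distrib[of "power _"] if_distrib[of "pochhammer _"] add_divide_distrib cong: if_cong)
  show "0 < (LINT x|simplex_measure. poly (p\<^sup>2) ((x :: real ^ 'n) $ i))" if "p \<noteq> 0" for p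
  proof -
    let ?I = "LINT x|simplex_measure. poly (p\<^sup>2) ((x :: real ^ 'n) $ i)"
    have nn: "AE x in simplex_measure. 0 \<le> poly (p\<^sup>2) ((x :: real ^ 'n) $ i)" by simp
    have "?I \<noteq> 0"
    proof
      assume "?I = 0"
      then have z: "AE x in simplex_measure. poly (p\<^sup>2) ((x :: real ^ 'n) $ i) = 0"
        using integral_nonneg_eq_0_iff_AE[OF integrable_simplex[OF cont] nn] by simp
      have nz: "AE x in (lborel :: (real ^ 'n) measure). \<forall>c\<in>{c. poly p c = 0}. x $ i \<noteq> c"
      proof (subst AE_ball_countable, goal_cases)
        case 1
        then show ?case using poly_roots_finite[OF that] by (simp add: countable_finite)
      next
        case 2
        have "AE x in (lborel :: (real ^ 'n) measure). x $ i \<noteq> c" for c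
        proof -
          have "{x :: real ^ 'n. x \<bullet> axis i 1 = c} \<in> null_sets lebesgue"
            using negligible_standard_hyperplane[of "axis i 1 :: real ^ 'n" c] by (simp add: negligible_iff_null_sets axis_in_Basis_iff)
          moreover have "{x :: real ^ 'n. x $ i = c} \<in> sets borel"
            by (intro borel_closed closed_Collect_eq continuous_intros)
          ultimately have "{x :: real ^ 'n. x $ i = c} \<in> null_sets lborel"
            by (simp add: inner_axis null_sets_completion_iff)
          then show ?thesis by (rule AE_I'[of "{x :: real ^ 'n. x $ i = c}"]) auto
        qed
        then show ?case by simp
      qed
      from z AE_simplexI[OF nz] have "AE x in (simplex_measure :: (real ^ 'n) measure). False"
        by eventually_elim auto
      then show False
        using emeasure_simplex[where ?'n = 'n] by (simp add: AE_iff_measurable[OF _ refl])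
    qed
    moreover have "?I \<ge> 0" using nn by (rule integral_nonneg_AE)
    ultimately show ?thesis by (simp add: less_le)
  qed
qed

section \<open>The law of the squared inner product with a unit vector\<close>

lemma continuous_on_signed_dot [continuous_intros]: "continuous_on A (\<lambda>x. signed_dot u x E)"
  unfolding signed_dot_def by (intro continuous_intros)

text \<open>The sign sum leaves only even exponents. Their Dirichlet moments are products over
  coordinates, up to a denominator that depends on the total m alone, so the sum reassembles into a
  power of the norm of u.\<close>

lemma signed_dot_moment:
  fixes u :: "'n::finite option \<Rightarrow> real"
  assumes u: "(\<Sum>j\<in>UNIV. (u j)\<^sup>2) = 1"
  shows "(LINT x|simplex_measure. (\<Sum>E\<in>UNIV. signed_dot u x E ^ (2 * m))) =
    2 ^ CARD('n option) * (pochhammer (1 / 2) m / pochhammer ((real CARD('n) + 1) / 2) m)"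
proof -
  \<comment> \<open>Coefficient of the exponent vector Z after the sign sum: each factor is 0 for an
    odd multiplicity and doubled for an even one.\<close>
  define \<kappa> where "\<kappa> Z = (\<Prod>j\<in>UNIV. (1 + (- 1) ^ count Z j) * u j ^ count Z j / fact (count Z j))" for Z
  let ?S = "multisets_of_size (UNIV :: 'n option set) (2 * m)"
  let ?p = "pochhammer ((real CARD('n) + 1) / 2) m"
  have fin: "finite ?S" by (rule finite_multisets_of_size) simp
  have size: "(\<Sum>j\<in>UNIV. count Z j) = 2 * m" if "Z \<in> ?S" for Z
  proof -
    have "(\<Sum>j\<in>UNIV. count Z j) = (\<Sum>j\<in>set_mset Z. count Z j)"
      by (intro sum.mono_neutral_right) (auto simp: not_in_iff)
    with that show ?thesis by (simp add: multisets_of_size_def size_multiset_overloaded_eq)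
  qed
  have "(\<Sum>E\<in>UNIV. signed_dot u x E ^ (2 * m)) = fact (2 * m) * (\<Sum>Z\<in>?S. \<kappa> Z * (\<Prod>j\<in>UNIV. sqrt (bary x j) ^ count Z j))" for x
    using sum_signs_power[of "\<lambda>j. u j * sqrt (bary x j)" "2 * m"]
    by (simp add: signed_dot_def \<kappa>_def power_mult_distrib prod.distrib[symmetric] field_simps)
  then have "(LINT x|simplex_measure. (\<Sum>E\<in>UNIV. signed_dot u x E ^ (2 * m)))
     = fact (2 * m) * (\<Sum>Z\<in>?S. \<kappa> Z * (LINT x|simplex_measure. (\<Prod>j\<in>UNIV. sqrt (bary x j) ^ count Z j)))"
    by (simp add: integrable_simplex continuous_intros)
  also have "(\<Sum>Z\<in>?S. \<kappa> Z * (LINT x|simplex_measure. (\<Prod>j\<in>UNIV. sqrt (bary x j) ^ count Z j)))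
     = (\<Sum>Z\<in>?S. (2 ^ CARD('n option) / ?p) * (\<Prod>j\<in>UNIV. if even (count Z j) then ((u j)\<^sup>2 / 4) ^ (count Z j div 2) / fact (count Z j div 2) else 0))"
  proof (rule sum.cong[OF refl])
    fix Z assume Z: "Z \<in> ?S"
    show "\<kappa> Z * (LINT x|simplex_measure. (\<Prod>j\<in>UNIV. sqrt (bary x j) ^ count Z j))
      = (2 ^ CARD('n option) / ?p) * (\<Prod>j\<in>UNIV. if even (count Z j) then ((u j)\<^sup>2 / 4) ^ (count Z j div 2) / fact (count Z j div 2) else 0)"
    proof (cases "\<forall>j. even (count Z j)")
      case False
      then obtain j where j: "odd (count Z j)" by blast
      then have "\<kappa> Z = 0" unfolding \<kappa>_def by (intro prod_zero bexI[of _ j]) simp_all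
      moreover have "(\<Prod>j\<in>UNIV. if even (count Z j) then ((u j)\<^sup>2 / 4) ^ (count Z j div 2) / fact (count Z j div 2) else 0) = 0"
        using j by (intro prod_zero) (auto intro!: bexI[of _ j])
      ultimately show ?thesis by (simp only: mult_zero_left mult_zero_right)
    next
      case True
      define \<beta> where "\<beta> j = count Z j div 2" for j
      have \<beta>: "count Z j = 2 * \<beta> j" for j using True by (simp add: \<beta>_def)
      have sum\<beta>: "(\<Sum>j\<in>UNIV. \<beta> j) = m" using size[OF Z] unfolding \<beta> sum_distrib_left[symmetric] by simp
      have "(LINT x|simplex_measure. (\<Prod>j\<in>UNIV. sqrt (bary x j) ^ count Z j)) = (LINT x|simplex_measure. (\<Prod>j\<in>UNIV. bary x j ^ \<beta> j))"
        by (intro integral_simplex_cong continuous_intros prod.cong) (auto simp: \<beta> power_mult std_simplex_bary)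
      also have "\<dots> = (\<Prod>j\<in>UNIV. pochhammer (1 / 2) (\<beta> j)) / ?p"
        unfolding integral_simplex_moment sum\<beta> ..
      finally have int: "(LINT x|simplex_measure. (\<Prod>j\<in>UNIV. sqrt (bary x j) ^ count Z j)) = \<dots>" .
      \<comment> \<open>Since (2k)! is 4^k k! times \<open>pochhammer (1 / 2) k\<close>, the
        Dirichlet factor cancels; this is the origin of the 4.\<close>
      have "(1 + (- 1) ^ (2 * k)) * u j ^ (2 * k) / fact (2 * k) * pochhammer (1 / 2) k = 2 * (((u j)\<^sup>2 / 4) ^ k / fact k)" for j k
      proof -
        have "pochhammer (1 / 2 :: real) k > 0" by (rule pochhammer_pos) simp
        then show ?thesis
          unfolding fact_double by (simp add: power_mult power_divide power2_eq_square)
      qed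
      then have "\<kappa> Z * (\<Prod>j\<in>UNIV. pochhammer (1 / 2) (\<beta> j)) = 2 ^ CARD('n option) * (\<Prod>j\<in>UNIV. ((u j)\<^sup>2 / 4) ^ \<beta> j / fact (\<beta> j))"
        unfolding \<kappa>_def \<beta> prod.distrib[symmetric] by (simp only: prod.distrib prod_constant)
      then show ?thesis unfolding int by (simp add: \<beta> field_simps del: card_option)
    qed
  qed
  also have "\<dots> = (2 ^ CARD('n option) / ?p) * ((\<Sum>j\<in>UNIV. (u j)\<^sup>2 / 4) ^ m / fact m)"
    unfolding sum_distrib_left[symmetric] sum_multisets_half_exp ..
  also have "(\<Sum>j\<in>UNIV. (u j)\<^sup>2 / 4) = 1 / 4"
    unfolding sum_divide_distrib[symmetric] u ..
  finally show ?thesis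
    unfolding fact_double by (simp add: power_mult power_divide del: card_option)
qed

text \<open>Rotation invariance in algebraic form: by linearity it suffices to compare moments, and
  those of the squared inner product are the Beta moments of one coordinate.\<close>

lemma signed_dot_integral:
  fixes u :: "'n::finite option \<Rightarrow> real"
  assumes u: "(\<Sum>j\<in>UNIV. (u j)\<^sup>2) = 1"
  shows "(LINT x|simplex_measure. (\<Sum>E\<in>UNIV. poly p ((signed_dot u x E)\<^sup>2))) =
    2 ^ CARD('n option) * (LINT x|(simplex_measure :: (real ^ 'n) measure). poly p (x $ i))"
proof -
  interpret jacobi_functional "real CARD('n) / 2" "\<lambda>p. LINT x|(simplex_measure :: (real ^ 'n) measure). poly p (x $ i)"
    by (rule coordinate_functional)
  have mom: "(LINT x|simplex_measure. (x $ i) ^ m) = pochhammer (1 / 2) m / pochhammer ((real CARD('n) + 1) / 2) m" for m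
    using L_moment[of m] by (simp add: poly_monom add_divide_distrib)
  have "(\<Sum>E\<in>UNIV. poly p ((signed_dot u x E)\<^sup>2)) = (\<Sum>m\<le>degree p. coeff p m * (\<Sum>E\<in>UNIV. signed_dot u x E ^ (2 * m)))" for x :: "real ^ 'n"
    unfolding poly_altdef by (subst sum.swap) (simp add: sum_distrib_left power_mult)
  then have "(LINT x|simplex_measure. (\<Sum>E\<in>UNIV. poly p ((signed_dot u x E)\<^sup>2)))
     = (\<Sum>m\<le>degree p. coeff p m * (LINT x|simplex_measure. (\<Sum>E\<in>UNIV. signed_dot u x E ^ (2 * m))))"
    by (simp add: integrable_simplex continuous_intros)
  also have "\<dots> = 2 ^ CARD('n option) * (\<Sum>m\<le>degree p. coeff p m * (LINT x|(simplex_measure :: (real ^ 'n) measure). (x $ i) ^ m))"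
    unfolding signed_dot_moment[OF u] mom by (simp add: sum_distrib_left mult_ac del: card_option)
  also have "(\<Sum>m\<le>degree p. coeff p m * (LINT x|(simplex_measure :: (real ^ 'n) measure). (x $ i) ^ m)) = (LINT x|(simplex_measure :: (real ^ 'n) measure). poly p (x $ i))"
    unfolding poly_altdef by (subst Bochner_Integration.integral_sum) (auto intro!: integrable_simplex continuous_intros)
  finally show ?thesis .
qed

subsection \<open>Growth of a polynomial near its minimizer\<close>

lemma trig_poly_of_circle:
  fixes f :: "'n::finite rpoly"
  assumes "total_degree f \<le> d"
  shows "trig_poly d (\<lambda>\<psi>. of_real (poly_eval f (\<chi> i. (cos (\<psi> / 2) * a i + sin (\<psi> / 2) * b i)\<^sup>2)))"
proof -
  have "trig_poly d (\<lambda>\<psi>. of_real (Poly_Mapping.lookup f \<alpha>) *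
      (\<Prod>i\<in>UNIV. of_real ((cos (\<psi> / 2) * a i + sin (\<psi> / 2) * b i)\<^sup>2) ^ Poly_Mapping.lookup \<alpha> i))"
    if "\<alpha> \<in> Poly_Mapping.keys f" for \<alpha>
  proof (rule trig_poly_mono)
    show "trig_poly (0 + (\<Sum>i\<in>UNIV. 1 * Poly_Mapping.lookup \<alpha> i)) (\<lambda>\<psi>. of_real (Poly_Mapping.lookup f \<alpha>) *
      (\<Prod>i\<in>UNIV. of_real ((cos (\<psi> / 2) * a i + sin (\<psi> / 2) * b i)\<^sup>2) ^ Poly_Mapping.lookup \<alpha> i))"
      by (intro trig_poly_mult trig_poly_const trig_poly_prod trig_poly_power trig_poly_square_cos_sin) simp
    show "0 + (\<Sum>i\<in>UNIV. 1 * Poly_Mapping.lookup \<alpha> i) \<le> d"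
      using that assms unfolding total_degree_le_iff by simp
  qed
  then have "trig_poly d (\<lambda>\<psi>. \<Sum>\<alpha>\<in>Poly_Mapping.keys f. of_real (Poly_Mapping.lookup f \<alpha>) *
      (\<Prod>i\<in>UNIV. of_real ((cos (\<psi> / 2) * a i + sin (\<psi> / 2) * b i)\<^sup>2) ^ Poly_Mapping.lookup \<alpha> i))"
    by (intro trig_poly_sum) auto
  then show ?thesis by (simp add: poly_eval_def)
qed

lemma signed_dot_square_le:
  assumes u: "(\<Sum>j\<in>UNIV. (u j)\<^sup>2) = 1" and x: "x \<in> std_simplex"
  shows "(signed_dot u x E)\<^sup>2 \<le> 1"
proof -
  have "(\<Sum>j\<in>UNIV. (sgn_of E j * sqrt (bary x j))\<^sup>2) = 1"
    using x sum_bary[of x] by (simp add: power_mult_distrib std_simplex_bary)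
  with Cauchy_Schwarz_ineq_sum[of u "\<lambda>j. sgn_of E j * sqrt (bary x j)" UNIV] u show ?thesis
    by (simp add: signed_dot_def)
qed

lemma std_simplex_of_unit:
  fixes z :: "'n::finite option \<Rightarrow> real"
  assumes "(\<Sum>j\<in>UNIV. (z j)\<^sup>2) = 1"
  shows "bary (\<chi> i. (z (Some i))\<^sup>2) j = (z j)\<^sup>2" "(\<chi> i. (z (Some i))\<^sup>2) \<in> std_simplex"
proof -
  show *: "bary (\<chi> i. (z (Some i))\<^sup>2) j = (z j)\<^sup>2" for j
    using assms by (cases j) (simp_all add: sum_option)
  then show "(\<chi> i. (z (Some i))\<^sup>2) \<in> std_simplex" by (simp add: std_simplex_bary *)
qed

lemma bary_inject:
  assumes "\<And>j. bary x j = bary y j"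
  shows "x = y"
  using assms[of "Some _"] by (simp add: vec_eq_iff)

text \<open>Lifting \<open>x\<close> to a point \<open>v\<close> of the unit sphere with squared coordinates \<open>bary x\<close>, the
  restriction of \<open>f\<close> to the great circle through \<open>u\<close> and \<open>v\<close> is a trigonometric polynomial of degree
  \<open>d\<close> in twice the angle.\<close>

lemma growth_near_minimizer:
  fixes f :: "'n::finite rpoly"
  assumes deg: "total_degree f \<le> d" and d: "d > 0"
    and y: "y \<in> std_simplex" and x: "x \<in> std_simplex"
    and lo: "\<And>z. z \<in> std_simplex \<Longrightarrow> poly_eval f y \<le> poly_eval f z"
    and hi: "\<And>z. z \<in> std_simplex \<Longrightarrow> poly_eval f z \<le> hi"
  defines "u \<equiv> \<lambda>j. sqrt (bary y j)"
  shows "poly_eval f x - poly_eval f y \<le> (real d)\<^sup>2 * (1 - (signed_dot u x E)\<^sup>2) * (hi - poly_eval f y)"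
proof -
  define v where "v j = sgn_of E j * sqrt (bary x j)" for j
  define t where "t = signed_dot u x E"
  have u2: "(u j)\<^sup>2 = bary y j" for j using y by (simp add: u_def std_simplex_bary)
  have v2: "(v j)\<^sup>2 = bary x j" for j using x by (simp add: v_def std_simplex_bary power_mult_distrib)
  have su: "(\<Sum>j\<in>UNIV. (u j)\<^sup>2) = 1" and sv: "(\<Sum>j\<in>UNIV. (v j)\<^sup>2) = 1"
    unfolding u2 v2 by (rule sum_bary)+
  have t: "t = (\<Sum>j\<in>UNIV. u j * v j)" by (simp add: t_def signed_dot_def v_def)
  have t1: "t\<^sup>2 \<le> 1" unfolding t_def by (rule signed_dot_square_le[OF su x])
  have sw: "(\<Sum>j\<in>UNIV. (v j - t * u j)\<^sup>2) = 1 - t\<^sup>2"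
  proof -
    have "(\<Sum>j\<in>UNIV. (v j - t * u j)\<^sup>2) = (\<Sum>j\<in>UNIV. (v j)\<^sup>2 - 2 * t * (u j * v j) + t\<^sup>2 * (u j)\<^sup>2)"
      by (simp add: power2_eq_square algebra_simps)
    also have "\<dots> = 1 - 2 * t * t + t\<^sup>2 * 1"
      by (simp only: sum.distrib sum_subtractf sum_distrib_left[symmetric] su sv t[symmetric])
    finally show ?thesis by (simp add: power2_eq_square)
  qed
  show ?thesis
  \<comment> \<open>In the degenerate case v is u or -u, so \<open>x = y\<close> and no great circle
    is needed.\<close>
  proof (cases "t\<^sup>2 = 1")
    case True
    then have "(v j - t * u j)\<^sup>2 = 0" for j
      using sw by (simp add: sum_nonneg_eq_0_iff)
    then have "(v j)\<^sup>2 = t\<^sup>2 * (u j)\<^sup>2" for j by (simp add: power_mult_distrib)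
    then have "bary x j = bary y j" for j using True by (simp add: u2 v2)
    then have "x = y" by (rule bary_inject)
    then show ?thesis using True by (simp add: t_def)
  next
    case False
    define s where "s = sqrt (1 - t\<^sup>2)"
    have s2: "s\<^sup>2 = 1 - t\<^sup>2" and s0: "s > 0" using t1 False by (simp_all add: s_def)
    \<comment> \<open>Gram-Schmidt: u and w form an orthonormal basis of the plane spanned by u and
      v.\<close>
    define w where "w j = (v j - t * u j) / s" for j
    have ww: "(\<Sum>j\<in>UNIV. (w j)\<^sup>2) = 1"
      unfolding w_def power_divide sum_divide_distrib[symmetric] sw s2 using False by simp
    have uw: "(\<Sum>j\<in>UNIV. u j * w j) = 0"
    proof -
      have "(\<Sum>j\<in>UNIV. u j * w j) = ((\<Sum>j\<in>UNIV. u j * v j) - t * (\<Sum>j\<in>UNIV. (u j)\<^sup>2)) / s"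
        by (simp add: w_def sum_divide_distrib sum_distrib_left sum_subtractf[symmetric] power2_eq_square algebra_simps diff_divide_distrib)
      then show ?thesis by (simp add: su t[symmetric])
    qed
    define z where "z \<psi> j = cos (\<psi> / 2) * u j + sin (\<psi> / 2) * w j" for \<psi> j
    define X where "X \<psi> = (\<chi> i. (z \<psi> (Some i))\<^sup>2)" for \<psi>
    have zz: "(\<Sum>j\<in>UNIV. (z \<psi> j)\<^sup>2) = 1" for \<psi>
    proof -
      have "(\<Sum>j\<in>UNIV. (z \<psi> j)\<^sup>2) = (\<Sum>j\<in>UNIV. (cos (\<psi> / 2))\<^sup>2 * (u j)\<^sup>2 + 2 * cos (\<psi> / 2) * sin (\<psi> / 2) * (u j * w j) + (sin (\<psi> / 2))\<^sup>2 * (w j)\<^sup>2)"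
        by (simp add: z_def power2_eq_square algebra_simps)
      also have "\<dots> = (cos (\<psi> / 2))\<^sup>2 * 1 + 2 * cos (\<psi> / 2) * sin (\<psi> / 2) * 0 + (sin (\<psi> / 2))\<^sup>2 * 1"
        by (simp only: sum.distrib sum_distrib_left[symmetric] su uw ww)
      finally show ?thesis by simp
    qed
    have X_in: "X \<psi> \<in> std_simplex" for \<psi> unfolding X_def by (rule std_simplex_of_unit(2)[OF zz])
    have X_bary: "bary (X \<psi>) j = (z \<psi> j)\<^sup>2" for \<psi> j unfolding X_def by (rule std_simplex_of_unit(1)[OF zz])
    have X0: "X 0 = y" by (rule bary_inject) (simp add: X_bary z_def u2)
    \<comment> \<open>The angle between u and v. The curve is parametrized by the doubled angle, so
      it reaches v at \<open>2 * \<theta>\<close>.\<close>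
    define \<theta> where "\<theta> = arccos t"
    have "\<bar>t\<bar> \<le> 1" using t1 by (simp add: abs_square_le_1)
    then have ct: "cos \<theta> = t" and st: "sin \<theta> = s"
      by (simp_all add: \<theta>_def s_def sin_arccos_abs)
    have "z (2 * \<theta>) j = v j" for j using s0 by (simp add: z_def ct st w_def)
    then have X1: "X (2 * \<theta>) = x" by (intro bary_inject) (simp add: X_bary v2)
    show ?thesis
    \<comment> \<open>If the two bounds coincide, f is constant on the simplex and cannot be
      normalized to the range from 0 to 1.\<close>
    proof (cases "hi = poly_eval f y")
      case True
      then show ?thesis using lo[OF x] hi[OF x] by simp
    next
      case False
      define D where "D = hi - poly_eval f y"
      have D: "D > 0" using False hi[OF y] by (simp add: D_def)
      define h where "h \<psi> = (poly_eval f (X \<psi>) - poly_eval f y) / D" for \<psi>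
      have "h (2 * \<theta>) \<le> (real d)\<^sup>2 * (sin (2 * \<theta> / 2))\<^sup>2"
      proof (rule trig_poly_bound_at_zero[OF _ d])
        have "trig_poly d (\<lambda>\<psi>. complex_of_real (poly_eval f (X \<psi>)) + of_real (- poly_eval f y))"
          unfolding X_def z_def
          by (intro trig_poly_add trig_poly_of_circle deg trig_poly_mono[OF trig_poly_const]) simp
        from trig_poly_mult[OF trig_poly_const[of "of_real (1 / D)"] this]
        show "trig_poly d (\<lambda>\<psi>. complex_of_real (h \<psi>))" by (simp add: h_def)
        show "h 0 = 0" by (simp add: h_def X0)
        show "0 \<le> h \<psi>" for \<psi> using D lo[OF X_in] by (simp add: h_def)
        show "h \<psi> \<le> 1" for \<psi> using D hi[OF X_in, of \<psi>] by (simp add: h_def D_def)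
      qed
      then have "(poly_eval f x - poly_eval f y) / D \<le> (real d)\<^sup>2 * (1 - t\<^sup>2)" by (simp add: h_def X1 st s2)
      then show ?thesis using D by (simp add: D_def[symmetric] t_def[symmetric] pos_divide_le_eq)
    qed
  qed
qed

subsection \<open>Upper bounds from the kernel\<close>

lemma preordering_nonneg:
  assumes "q \<in> simplex_preordering m" "x \<in> std_simplex"
  shows "poly_eval q x \<ge> 0"
proof -
  obtain \<sigma> where q: "q = (\<Sum>J\<in>UNIV. \<sigma> J * (\<Prod>j\<in>J. simplex_constraint j))" and \<sigma>: "\<And>J. \<sigma> J \<in> sos_polys"
    using assms(1) unfolding simplex_preordering_def by blast
  have "poly_eval (\<sigma> J) x \<ge> 0" for J
    using \<sigma>[of J] unfolding sos_polys_def by (auto intro!: sum_nonneg)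
  then show ?thesis
    unfolding q using assms(2)
    by (auto simp: poly_eval_constraint std_simplex_bary intro!: sum_nonneg mult_nonneg_nonneg prod_nonneg)
qed

text \<open>The growth bound holds at every lift separately, so it may be weighted by
  \<open>P\<^sup>2\<close> at that lift before summing; 1 - <u, v>^2 becomes the factor
  \<open>[:1, - 1:]\<close>. The bound \<open>hi\<close> is free so that \<open>- p\<^sup>2\<close>
  can be treated with \<open>hi = 0\<close>.\<close>

lemma kernel_upper_bound:
  fixes f :: "'n::finite rpoly"
  assumes "degree P \<le> r" and norm: "(LINT x|(simplex_measure :: (real ^ 'n) measure). poly (P\<^sup>2) (x $ i)) = 1"
    and deg: "total_degree f \<le> d" and d: "d > 0" and y: "y \<in> std_simplex"
    and lo: "\<And>z. z \<in> std_simplex \<Longrightarrow> poly_eval f y \<le> poly_eval f z"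
    and hi: "\<And>z. z \<in> std_simplex \<Longrightarrow> poly_eval f z \<le> hi"
  defines "q \<equiv> zonal_kernel P (\<lambda>j. sqrt (bary y j))"
  shows "(LINT x|simplex_measure. poly_eval q x) = 1"
    and "(LINT x|simplex_measure. poly_eval f x * poly_eval q x) - poly_eval f y
       \<le> (real d)\<^sup>2 * (hi - poly_eval f y) * (LINT x|(simplex_measure :: (real ^ 'n) measure). poly ([:1, - 1:] * P\<^sup>2) (x $ i))"
proof -
  define u where "u j = sqrt (bary y j)" for j
  have su: "(\<Sum>j\<in>UNIV. (u j)\<^sup>2) = 1"
    using y sum_bary[of y] by (simp add: u_def std_simplex_bary)
  let ?K = "2 ^ CARD('n option) :: real"
  let ?S = "\<lambda>p x. \<Sum>E\<in>UNIV. poly p ((signed_dot u x E)\<^sup>2)"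
  have q: "poly_eval q x = ?S (P\<^sup>2) x / ?K" if "x \<in> std_simplex" for x
    using kernel_eval[OF that, of P u] by (simp add: q_def u_def[abs_def] field_simps del: card_option)
  have contS: "continuous_on UNIV (?S p)" for p
    by (intro continuous_intros)
  have intS: "(LINT x|simplex_measure. ?S p x / ?K) = (LINT x|(simplex_measure :: (real ^ 'n) measure). poly p (x $ i))" for p
    using signed_dot_integral[OF su, of p i] by simp
  have "(LINT x|simplex_measure. poly_eval q x) = (LINT x|simplex_measure. ?S (P\<^sup>2) x / ?K)"
    by (intro integral_simplex_cong continuous_intros contS) (simp_all add: q)
  then show one: "(LINT x|simplex_measure. poly_eval q x) = 1"
    unfolding intS norm .
  let ?D = "(real d)\<^sup>2 * (hi - poly_eval f y)"
  have "(LINT x|simplex_measure. (poly_eval f x - poly_eval f y) * poly_eval q x)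
      \<le> (LINT x|simplex_measure. ?D * (?S ([:1, - 1:] * P\<^sup>2) x / ?K))"
  proof (intro integral_simplex_mono continuous_intros contS)
    fix x :: "real ^ 'n" assume x: "x \<in> std_simplex"
    have "(poly_eval f x - poly_eval f y) * ?S (P\<^sup>2) x = (\<Sum>E\<in>UNIV. (poly_eval f x - poly_eval f y) * poly (P\<^sup>2) ((signed_dot u x E)\<^sup>2))"
      by (rule sum_distrib_left)
    also have "\<dots> \<le> (\<Sum>E\<in>UNIV. (real d)\<^sup>2 * (1 - (signed_dot u x E)\<^sup>2) * (hi - poly_eval f y) * poly (P\<^sup>2) ((signed_dot u x E)\<^sup>2))"
      unfolding u_def by (intro sum_mono mult_right_mono growth_near_minimizer[OF deg d y x lo hi]) simp_all
    also have "\<dots> = ?D * ?S ([:1, - 1:] * P\<^sup>2) x"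
      by (simp add: sum_distrib_left algebra_simps)
    finally show "(poly_eval f x - poly_eval f y) * poly_eval q x \<le> ?D * (?S ([:1, - 1:] * P\<^sup>2) x / ?K)"
      unfolding q[OF x] by (simp add: divide_right_mono)
  qed simp_all
  also have "\<dots> = ?D * (LINT x|simplex_measure. ?S ([:1, - 1:] * P\<^sup>2) x / ?K)"
    by (rule integral_mult_right_zero)
  finally have "(LINT x|simplex_measure. (poly_eval f x - poly_eval f y) * poly_eval q x)
      \<le> ?D * (LINT x|(simplex_measure :: (real ^ 'n) measure). poly ([:1, - 1:] * P\<^sup>2) (x $ i))"
    unfolding intS .
  moreover have "(LINT x|simplex_measure. (poly_eval f x - poly_eval f y) * poly_eval q x)
     = (LINT x|simplex_measure. poly_eval f x * poly_eval q x) - poly_eval f y * (LINT x|simplex_measure. poly_eval q x)"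
    by (simp add: left_diff_distrib integrable_simplex continuous_intros)
  ultimately show "(LINT x|simplex_measure. poly_eval f x * poly_eval q x) - poly_eval f y
       \<le> ?D * (LINT x|(simplex_measure :: (real ^ 'n) measure). poly ([:1, - 1:] * P\<^sup>2) (x $ i))"
    by (simp add: one)
qed

text \<open>The arguments of \<open>P\<close> stay in [0, 1], so its maximum there gives a bound
  uniform in the center y.\<close>

lemma kernel_bounded:
  obtains B where "\<And>y x :: real ^ 'n::finite. y \<in> std_simplex \<Longrightarrow> x \<in> std_simplex \<Longrightarrow> poly_eval (zonal_kernel P (\<lambda>j. sqrt (bary y j))) x \<le> B"
proof -
  have "compact ((\<lambda>s. (poly P s)\<^sup>2) ` {0..1})"
    by (intro compact_continuous_image continuous_intros) simp
  then obtain B where B: "\<And>s. s \<in> {0..1} \<Longrightarrow> norm ((poly P s)\<^sup>2) \<le> B"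
    by (meson bounded_iff compact_imp_bounded imageI)
  have "poly_eval (zonal_kernel P (\<lambda>j. sqrt (bary y j))) x \<le> 2 ^ CARD('n option) * B / 2 ^ CARD('n option)"
    if y: "y \<in> std_simplex" and x: "x \<in> std_simplex" for x y :: "real ^ 'n"
  proof -
    let ?u = "\<lambda>j. sqrt (bary y j)"
    have su: "(\<Sum>j\<in>UNIV. (?u j)\<^sup>2) = 1" using y sum_bary[of y] by (simp add: std_simplex_bary)
    have "(\<Sum>E\<in>UNIV. (poly P ((signed_dot ?u x E)\<^sup>2))\<^sup>2) \<le> (\<Sum>E\<in>(UNIV :: 'n option set set). B)"
      using B signed_dot_square_le[OF su x] by (intro sum_mono) (simp add: abs_of_nonneg)
    also have "\<dots> = 2 ^ CARD('n option) * B" by (simp add: card_UNIV_set del: card_option)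
    finally have "2 ^ CARD('n option) * poly_eval (zonal_kernel P ?u) x \<le> 2 ^ CARD('n option) * B"
      unfolding kernel_eval[OF x, of P ?u] .
    then show ?thesis by (simp only: mult_le_cancel_left_pos zero_less_power zero_less_numeral) simp
  qed
  then show thesis by (intro that) simp
qed

lemma simplex_kernel:
  assumes "r > 0"
  obtains P where "degree P \<le> r"
    "(LINT x|(simplex_measure :: (real ^ 'n::finite) measure). poly (P\<^sup>2) (x $ i)) = 1"
    "(LINT x|(simplex_measure :: (real ^ 'n::finite) measure). poly ([:1, - 1:] * P\<^sup>2) (x $ i)) \<le> (real CARD('n))\<^sup>2 / (real r)\<^sup>2"
proof -
  interpret jacobi_functional "real CARD('n) / 2" "\<lambda>p. LINT x|(simplex_measure :: (real ^ 'n) measure). poly p (x $ i)"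
    by (rule coordinate_functional)
  obtain P where P: "degree P \<le> r" "(LINT x|(simplex_measure :: (real ^ 'n) measure). poly (P\<^sup>2) (x $ i)) = 1"
    "(LINT x|(simplex_measure :: (real ^ 'n) measure). poly (Y * P\<^sup>2) (x $ i)) \<le> real CARD('n) / 2 * (real CARD('n) / 2 + 2) / (2 * (real r)\<^sup>2)"
    using jacobi_kernel[OF assms] by blast
  \<comment> \<open>With a = N / 2 the constant is N^2 / 8 + N / 2, which is at most N^2 for N >=
    1.\<close>
  have "real CARD('n) / 2 * (real CARD('n) / 2 + 2) / (2 * (real r)\<^sup>2) \<le> (real CARD('n))\<^sup>2 / (real r)\<^sup>2"
  proof -
    have "N / 2 * (N / 2 + 2) / 2 \<le> N\<^sup>2" if "1 \<le> N" for N :: real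
    proof -
      have "N / 2 * (N / 2 + 2) / 2 = N\<^sup>2 / 8 + N / 2" by (simp add: power2_eq_square field_simps)
      moreover have "N \<le> N\<^sup>2" using that by (rule self_le_power) simp
      moreover have "0 \<le> N\<^sup>2" by simp
      ultimately show ?thesis by linarith
    qed
    from this[of "real CARD('n)"] have "real CARD('n) / 2 * (real CARD('n) / 2 + 2) / 2 \<le> (real CARD('n))\<^sup>2"
      by (simp add: Suc_leI)
    then have "real CARD('n) / 2 * (real CARD('n) / 2 + 2) / 2 / (real r)\<^sup>2 \<le> (real CARD('n))\<^sup>2 / (real r)\<^sup>2"
      by (rule divide_right_mono) simp
    then show ?thesis by simp
  qed
  with P(3) have "(LINT x|(simplex_measure :: (real ^ 'n) measure). poly ([:1, - 1:] * P\<^sup>2) (x $ i)) \<le> (real CARD('n))\<^sup>2 / (real r)\<^sup>2"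
    unfolding Y_def by (rule order_trans)
  with P(1,2) show thesis by (rule that)
qed

subsection \<open>The constant gamma\<close>

lemma simplex_attains:
  fixes g :: "real ^ 'n::finite \<Rightarrow> real"
  assumes "continuous_on UNIV g"
  obtains y z where "y \<in> std_simplex" "z \<in> std_simplex" "\<And>x. x \<in> std_simplex \<Longrightarrow> g y \<le> g x \<and> g x \<le> g z"
proof -
  have c: "continuous_on std_simplex g" using assms by (rule continuous_on_subset) simp
  have ne: "std_simplex \<noteq> {}" using zero_in_std_simplex by blast
  show thesis
    using continuous_attains_inf[OF compact_std_simplex ne c] continuous_attains_sup[OF compact_std_simplex ne c] that
    by metis
qed

lemma simplex_norm_bounds:
  fixes p :: "'n::finite rpoly"
  shows "x \<in> std_simplex \<Longrightarrow> \<bar>poly_eval p x\<bar> \<le> simplex_norm p"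
    and "\<exists>y\<in>std_simplex. simplex_norm p = \<bar>poly_eval p y\<bar>"
proof -
  obtain y z where z: "z \<in> std_simplex" "\<And>x. x \<in> std_simplex \<Longrightarrow> \<bar>poly_eval p x\<bar> \<le> \<bar>poly_eval p z\<bar>"
    by (rule simplex_attains[of "\<lambda>x. \<bar>poly_eval p x\<bar>"]) (auto intro!: continuous_intros)
  have "simplex_norm p = \<bar>poly_eval p z\<bar>"
    unfolding simplex_norm_def using z by (intro cSup_eq_maximum) auto
  with z show "x \<in> std_simplex \<Longrightarrow> \<bar>poly_eval p x\<bar> \<le> simplex_norm p" "\<exists>y\<in>std_simplex. simplex_norm p = \<bar>poly_eval p y\<bar>"
    by auto
qed

text \<open>Applied to \<open>- p\<^sup>2\<close>, the upper bound says that \<open>p\<^sup>2\<close> is at least half its maximum on average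
  with respect to a kernel that is bounded independently of \<open>p\<close>.\<close>

lemma simplex_norm_le_L2:
  obtains C where "C > 0" "\<And>p :: 'n::finite rpoly. total_degree p \<le> d \<Longrightarrow> (simplex_norm p)\<^sup>2 \<le> C * simplex_inner p p"
proof -
  \<comment> \<open>A degree bound for \<open>p\<^sup>2\<close>, raised by 1 to be positive also for
    \<open>d = 0\<close>.\<close>
  define m where "m = 2 * d + 1"
  \<comment> \<open>Chosen so that m^2 n^2 / r^2 = 1/4: the kernel loses at most a quarter of the
    maximum.\<close>
  define r where "r = 2 * m * CARD('n)"
  have m: "m > 0" and r: "r > 0" by (simp_all add: m_def r_def)
  obtain i :: 'n where True by simp
  obtain P where P: "degree P \<le> r"
    "(LINT x|(simplex_measure :: (real ^ 'n) measure). poly (P\<^sup>2) (x $ i)) = 1"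
    "(LINT x|(simplex_measure :: (real ^ 'n) measure). poly ([:1, - 1:] * P\<^sup>2) (x $ i)) \<le> (real CARD('n))\<^sup>2 / (real r)\<^sup>2"
    by (rule simplex_kernel[OF r])
  obtain B where B: "\<And>y x :: real ^ 'n. y \<in> std_simplex \<Longrightarrow> x \<in> std_simplex \<Longrightarrow> poly_eval (zonal_kernel P (\<lambda>j. sqrt (bary y j))) x \<le> B"
    using kernel_bounded[of P] by blast
  define C where "C = 2 * max B 1"
  have "(simplex_norm p)\<^sup>2 \<le> C * simplex_inner p p" if deg: "total_degree p \<le> d" for p :: "'n rpoly"
  proof -
    obtain y where y: "y \<in> std_simplex" "simplex_norm p = \<bar>poly_eval p y\<bar>"
      using simplex_norm_bounds(2) by blast
    define N where "N = (poly_eval p y)\<^sup>2"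
    define q where "q = zonal_kernel P (\<lambda>j. sqrt (bary y j))"
    have deg2: "total_degree (- (p\<^sup>2)) \<le> m"
      using total_degree_mult[of p p] deg by (simp add: m_def power2_eq_square)
    have lo: "poly_eval (- (p\<^sup>2)) y \<le> poly_eval (- (p\<^sup>2)) z" if "z \<in> std_simplex" for z
      using simplex_norm_bounds(1)[OF that, of p] y(2) by (simp add: abs_le_square_iff)
    have "(LINT x|simplex_measure. poly_eval (- (p\<^sup>2)) x * poly_eval q x) - poly_eval (- (p\<^sup>2)) y
        \<le> (real m)\<^sup>2 * (0 - poly_eval (- (p\<^sup>2)) y) * (LINT x|(simplex_measure :: (real ^ 'n) measure). poly ([:1, - 1:] * P\<^sup>2) (x $ i))"
      unfolding q_def by (rule kernel_upper_bound(2)[OF P(1,2) deg2 m y(1) lo]) simp_all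
    also have "0 - poly_eval (- (p\<^sup>2)) y = N" by (simp add: N_def)
    also have "(real m)\<^sup>2 * N * (LINT x|(simplex_measure :: (real ^ 'n) measure). poly ([:1, - 1:] * P\<^sup>2) (x $ i))
        \<le> (real m)\<^sup>2 * N * ((real CARD('n))\<^sup>2 / (real r)\<^sup>2)"
      by (rule mult_left_mono[OF P(3)]) (simp add: N_def)
    also have "\<dots> = N / 4" using m by (simp add: r_def power_mult_distrib)
    finally have "3 * N \<le> 4 * (LINT x|simplex_measure. (poly_eval p x)\<^sup>2 * poly_eval q x)"
      by (simp add: N_def)
    moreover have "0 \<le> N" by (simp add: N_def)
    ultimately have "N \<le> 2 * (LINT x|simplex_measure. (poly_eval p x)\<^sup>2 * poly_eval q x)"
      by linarith
    also have "(LINT x|simplex_measure. (poly_eval p x)\<^sup>2 * poly_eval q x) \<le> (LINT x|simplex_measure. max B 1 * (poly_eval p x * poly_eval p x))"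
    proof (intro integral_simplex_mono continuous_intros)
      fix x :: "real ^ 'n" assume "x \<in> std_simplex"
      from B[OF y(1) this] have "poly_eval q x \<le> max B 1" by (simp add: q_def)
      then have "(poly_eval p x)\<^sup>2 * poly_eval q x \<le> (poly_eval p x)\<^sup>2 * max B 1"
        by (intro mult_left_mono) simp_all
      then show "(poly_eval p x)\<^sup>2 * poly_eval q x \<le> max B 1 * (poly_eval p x * poly_eval p x)"
        by (simp only: power2_eq_square mult_ac)
    qed
    also have "\<dots> = max B 1 * simplex_inner p p"
      unfolding simplex_inner_def by (rule integral_mult_right_zero)
    finally show ?thesis by (simp add: C_def y(2) N_def)
  qed
  moreover have "C > 0" by (simp add: C_def)
  ultimately show thesis by (intro that)
qed

section \<open>Orthogonal components and boundedness of their norm quotients\<close>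

lemma simplex_inner_sum_left: "simplex_inner (\<Sum>a\<in>A. p a) s = (\<Sum>a\<in>A. simplex_inner (p a) s)"
  unfolding simplex_inner_def by (simp add: sum_distrib_right integrable_simplex continuous_intros)

lemma simplex_inner_commute: "simplex_inner p q = simplex_inner q p"
  by (simp add: simplex_inner_def mult.commute)

lemma simplex_inner_sum_right: "simplex_inner s (\<Sum>a\<in>A. p a) = (\<Sum>a\<in>A. simplex_inner s (p a))"
  by (simp add: simplex_inner_commute[of s] simplex_inner_sum_left)

lemma simplex_inner_nonneg: "simplex_inner p p \<ge> 0"
  unfolding simplex_inner_def by (intro integral_nonneg_AE) simp

lemma simplex_inner_le_norm: "simplex_inner p p \<le> (simplex_norm (p :: 'n::finite rpoly))\<^sup>2"
proof -
  have "simplex_inner p p \<le> (LINT x|(simplex_measure :: (real ^ 'n) measure). (simplex_norm p)\<^sup>2)"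
    unfolding simplex_inner_def
  proof (intro integral_simplex_mono continuous_intros)
    fix x :: "real ^ 'n" assume "x \<in> std_simplex"
    then have "\<bar>poly_eval p x\<bar>\<^sup>2 \<le> (simplex_norm p)\<^sup>2" by (intro power_mono simplex_norm_bounds) auto
    then show "poly_eval p x * poly_eval p x \<le> (simplex_norm p)\<^sup>2" by (simp add: power2_eq_square)
  qed
  then show ?thesis by (simp only: integral_simplex_const)
qed

lemma simplex_H_orthogonal:
  assumes "p \<in> simplex_H i" "q \<in> simplex_H j" "i \<noteq> j"
  shows "simplex_inner p q = 0"
  using assms simplex_inner_commute[of p q] unfolding simplex_H_def by (cases "i < j") auto

text \<open>Pythagoras for pairwise orthogonal components.\<close>

lemma simplex_component_norm:
  assumes "\<forall>j\<le>d. h j \<in> simplex_H j" "k \<le> d"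
  shows "simplex_inner (h k) (h k) \<le> simplex_inner (\<Sum>j\<le>d. h j) (\<Sum>j\<le>d. h j)"
proof -
  have "simplex_inner (\<Sum>j\<le>d. h j) (\<Sum>j\<le>d. h j) = (\<Sum>i\<le>d. \<Sum>j\<le>d. simplex_inner (h i) (h j))"
    unfolding simplex_inner_sum_left unfolding simplex_inner_sum_right ..
  also have "\<dots> = (\<Sum>i\<le>d. \<Sum>j\<le>d. if i = j then simplex_inner (h i) (h i) else 0)"
    using assms(1) by (intro sum.cong refl) (auto intro: simplex_H_orthogonal)
  also have "\<dots> = (\<Sum>i\<le>d. simplex_inner (h i) (h i))" by simp
  also have "\<dots> \<ge> simplex_inner (h k) (h k)"
    using assms(2) by (intro member_le_sum) (auto simp: simplex_inner_nonneg)
  finally show ?thesis .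
qed

text \<open>The set of quotients is bounded: the sup norm of a component is at most
  \<open>sqrt C\<close> times its L2 norm, hence times that of p, hence times the sup norm of p. The
  constant polynomial 1 contributes the quotient 1.\<close>

lemma simplex_gamma_ge_1: "simplex_gamma TYPE('n::finite) d \<ge> 1"
proof -
  obtain C where C: "C > 0" "\<And>p :: 'n rpoly. total_degree p \<le> d \<Longrightarrow> (simplex_norm p)\<^sup>2 \<le> C * simplex_inner p p"
    using simplex_norm_le_L2[of d] by blast
  have norm_nn: "simplex_norm p \<ge> 0" for p :: "'n rpoly"
    using simplex_norm_bounds(2)[of p] by auto
  have "simplex_norm (h k) / simplex_norm p \<le> sqrt C"
    if "p \<noteq> 0" "total_degree p \<le> d" "k \<le> d" "\<forall>j\<le>d. h j \<in> simplex_H j" "p = (\<Sum>j\<le>d. h j)"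
    for p :: "'n rpoly" and h k
  proof -
    have "total_degree (h k) \<le> d" using that(3,4) unfolding simplex_H_def by fastforce
    then have "(simplex_norm (h k))\<^sup>2 \<le> C * simplex_inner (h k) (h k)" by (rule C(2))
    also have "\<dots> \<le> C * simplex_inner p p"
      using C(1) simplex_component_norm[OF that(4,3)] that(5) by (simp add: mult_left_mono)
    also have "\<dots> \<le> C * (simplex_norm p)\<^sup>2"
      using C(1) simplex_inner_le_norm[of p] by (simp add: mult_left_mono)
    also have "\<dots> = (sqrt C * simplex_norm p)\<^sup>2" using C(1) by (simp add: power_mult_distrib)
    finally have "simplex_norm (h k) \<le> sqrt C * simplex_norm p"
      by (rule power2_le_imp_le) (use C(1) norm_nn in simp)
    \<comment> \<open>A zero denominator is harmless, as \<open>x / 0 = 0\<close>.\<close>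
    then show ?thesis using norm_nn[of p] C(1) by (cases "simplex_norm p = 0") (auto simp: pos_divide_le_eq)
  qed
  then have bdd: "bdd_above {simplex_norm (h k) / simplex_norm p | (p :: 'n rpoly) (h :: nat \<Rightarrow> 'n rpoly) k.
            p \<noteq> 0 \<and> total_degree p \<le> d \<and> k \<le> d \<and>
            (\<forall>j\<le>d. h j \<in> simplex_H j) \<and> p = (\<Sum>j\<le>d. h j)}"
    by (intro bdd_aboveI[of _ "sqrt C"]) blast
  define h :: "nat \<Rightarrow> 'n rpoly" where "h j = (if j = 0 then 1 else 0)" for j
  have norm1: "simplex_norm (1 :: 'n rpoly) = 1"
    using simplex_norm_bounds(2)[of "1 :: 'n rpoly"] by simp
  have "h j \<in> simplex_H j" for j
    by (auto simp: h_def simplex_H_def simplex_inner_def)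
  moreover have "1 = (\<Sum>j\<le>d. h j)" by (simp add: h_def)
  ultimately have "1 \<in> {simplex_norm (h k) / simplex_norm p | (p :: 'n rpoly) (h :: nat \<Rightarrow> 'n rpoly) k.
            p \<noteq> 0 \<and> total_degree p \<le> d \<and> k \<le> d \<and>
            (\<forall>j\<le>d. h j \<in> simplex_H j) \<and> p = (\<Sum>j\<le>d. h j)}"
    by (intro CollectI exI[of _ 1] exI[of _ h] exI[of _ 0]) (auto simp: norm1 h_def[of 0])
  then show ?thesis unfolding simplex_gamma_def using bdd by (rule cSup_upper)
qed

theorem theorem6:
  fixes f :: "'n::finite rpoly" and d r :: nat
  assumes "d \<ge> 1" and "total_degree f = d" and "r \<ge> d"
  shows "simplex_ub f r - simplex_min f
           \<le> simplex_C TYPE('n) d / (2 * (real r)\<^sup>2) * (simplex_max f - simplex_min f)"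
proof -
  obtain y z where y: "y \<in> std_simplex" and z: "z \<in> std_simplex"
    and yz: "\<And>x. x \<in> std_simplex \<Longrightarrow> poly_eval f y \<le> poly_eval f x \<and> poly_eval f x \<le> poly_eval f z"
    by (rule simplex_attains[of "poly_eval f"]) (auto intro!: continuous_intros)
  have min: "simplex_min f = poly_eval f y"
    unfolding simplex_min_def using y yz by (intro cInf_eq_minimum) auto
  have max: "simplex_max f = poly_eval f z"
    unfolding simplex_max_def using z yz by (intro cSup_eq_maximum) auto
  have d: "d > 0" and r: "r > 0" using assms by auto
  obtain i :: 'n where True by simp
  obtain P where P: "degree P \<le> r"
    "(LINT x|(simplex_measure :: (real ^ 'n) measure). poly (P\<^sup>2) (x $ i)) = 1"
    "(LINT x|(simplex_measure :: (real ^ 'n) measure). poly ([:1, - 1:] * P\<^sup>2) (x $ i)) \<le> (real CARD('n))\<^sup>2 / (real r)\<^sup>2"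
    by (rule simplex_kernel[OF r])
  define q where "q = zonal_kernel P (\<lambda>j. sqrt (bary y j))"
  have q: "q \<in> simplex_preordering (2 * r)" unfolding q_def by (rule kernel_in_preordering[OF P(1)])
  have deg: "total_degree f \<le> d" using assms by simp
  note ub = kernel_upper_bound[OF P(1,2) deg d y, folded q_def, of "poly_eval f z"]
  have one: "(LINT x|simplex_measure. poly_eval q x) = 1"
    by (rule ub(1)) (use yz in auto)
  \<comment> \<open>Feasible means cannot fall below the minimum; the infimum of reals needs this
    lower bound before it can be compared with the value at the kernel.\<close>
  have bdd: "poly_eval f y \<le> (LINT x|simplex_measure. poly_eval f x * poly_eval q x)"
    if "q \<in> simplex_preordering (2 * r)" "(LINT x|simplex_measure. poly_eval q x) = 1" for q
  proof -
    have "poly_eval f y = (LINT x|simplex_measure. poly_eval f y * poly_eval q x)"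
      using that(2) by simp
    also have "\<dots> \<le> (LINT x|simplex_measure. poly_eval f x * poly_eval q x)"
      by (intro integral_simplex_mono continuous_intros mult_right_mono)
         (use yz preordering_nonneg[OF that(1)] in auto)
    finally show ?thesis .
  qed
  have "simplex_ub f r \<le> (LINT x|simplex_measure. poly_eval f x * poly_eval q x)"
    unfolding simplex_ub_def
  proof (rule cInf_lower)
    show "(LINT x|simplex_measure. poly_eval f x * poly_eval q x) \<in>
      {(LINT x|simplex_measure. poly_eval f x * poly_eval q x) | q.
            q \<in> simplex_preordering (2 * r) \<and> (LINT x|simplex_measure. poly_eval q x) = 1}"
      using q one by blast
    show "bdd_below {(LINT x|simplex_measure. poly_eval f x * poly_eval q x) | q.
            q \<in> simplex_preordering (2 * r) \<and> (LINT x|simplex_measure. poly_eval q x) = 1}"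
      using bdd by (intro bdd_belowI[of _ "poly_eval f y"]) blast
  qed
  then have "simplex_ub f r - poly_eval f y \<le> (LINT x|simplex_measure. poly_eval f x * poly_eval q x) - poly_eval f y"
    by simp
  also have "\<dots> \<le> (real d)\<^sup>2 * (poly_eval f z - poly_eval f y) * (LINT x|(simplex_measure :: (real ^ 'n) measure). poly ([:1, - 1:] * P\<^sup>2) (x $ i))"
    by (rule ub(2)) (use yz in auto)
  also have "\<dots> \<le> (real d)\<^sup>2 * (poly_eval f z - poly_eval f y) * ((real CARD('n))\<^sup>2 / (real r)\<^sup>2)"
    using P(3) yz[OF z] by (intro mult_left_mono) simp_all
  also have "\<dots> = (real CARD('n))\<^sup>2 * (real d)\<^sup>2 * 1 / (real r)\<^sup>2 * (poly_eval f z - poly_eval f y)"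
    by simp
  \<comment> \<open>Enlarges the constant by \<open>d\<^sup>2 \<le> d ^ 3\<close> and
    \<open>1 \<le> simplex_gamma TYPE('n) d\<close>.\<close>
  also have "\<dots> \<le> (real CARD('n))\<^sup>2 * (real d ^ 3) * simplex_gamma TYPE('n) d / (real r)\<^sup>2 * (poly_eval f z - poly_eval f y)"
    using yz[OF z] simplex_gamma_ge_1[of d, where ?'n = 'n] d
    by (intro mult_right_mono divide_right_mono mult_mono) (auto intro: power_increasing)
  also have "\<dots> = simplex_C TYPE('n) d / (2 * (real r)\<^sup>2) * (simplex_max f - simplex_min f)"
    by (simp add: simplex_C_def min max)
  finally show ?thesis by (simp only: min)
qed

end
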